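(* Let $\nu,\rho\in\mathbb{Z}$ with $\rho-\nu\in2\mathbb{Z}$, and let $\mathcal{C}_{\nu,\rho}$ be the representation space consisting of the formal power series $$f=\sum_{\ell\in\mathbb{Z}_{\ge0}}\mu_\ell\,u_\ell,\qquad u_\ell=\hat b^\ell\,\hat d^{\nu-\ell}\,\omega^{(\rho-\nu)/2},\qquad \mu_\ell\in\mathbb{C},$$ where $\hat b,\hat d,\omega$ are as in the context. Then the left action $\pi_L$ of $s14o$ gives an infinite-dimensional representation $\pi_{\nu,\rho}$ on $\mathcal{C}_{\nu,\rho}$, with $$\tilde A\,u_\ell=-\rho\,u_\ell,\quad \tilde B\,u_\ell=(\nu-2\ell)u_\ell,\quad X^+u_\ell=(-1)^{\ell-1}\ell\,u_{\ell-1},\quad X^-u_\ell=(-1)^{\ell+1}(\ell-\nu)u_{\ell+1}.$$ It is a highest weight representation, since $X^+u_0=0$. Writing the functions instead as $\varphi=\sum_{\ell\in\mathbb{Z}_{\ge0}}\alpha_\ell v_\ell$ with $v_\ell=\eta^\ell\hat d^\nu\omega^{(\rho-\nu)/2}$, $\eta=\hat b\hat d^{-1}$, the action of $\tilde A,\tilde B$ on $v_\ell$ has the same form as on $u_\ell$, and $$X^+v_\ell=\ell\,v_{\ell-1},\qquad X^-v_\ell=(\nu-\ell)v_{\ell+1}.$$ If $\nu\in\mathbb{Z}_{\ge0}$, then the representation is reducible: $X^-u_\nu=0$, so the vectors $u_0,\dots,u_\nu$ form an invariant subspace $\mathcal{E}_{\nu,\rho}$ of dimension $\nu+1$, and one has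 two irreducible representations, with representation spaces isomorphic to $\mathcal{E}_{\nu,\rho}$ and to the infinite-dimensional quotient $\mathcal{C}_{\nu,\rho}/\mathcal{E}_{\nu,\rho}$. If $\nu\notin\mathbb{Z}_{\ge0}$, then the representation $\mathcal{C}_{\nu,\rho}$ is irreducible.
   Context: $S14o$ is the unital associative $\mathbb{C}$-algebra generated by $\hat a,\hat b,\hat c,\hat d$ with relations $\hat b\hat a=-\hat a\hat b$, $\hat c\hat a=-\hat a\hat c$, $\hat d\hat a=\hat a\hat d$, $\hat c\hat b=\hat b\hat c$, $\hat b\hat d=-\hat d\hat b$, $\hat c\hat d=-\hat d\hat c$, with coproduct $\delta(T_{ij})=\sum_kT_{ik}\otimes T_{kj}$ and counit $\varepsilon(T_{ij})=\delta_{ij}$ for $T=\begin{pmatrix}\hat a&\hat b\\\hat c&\hat d\end{pmatrix}$. Put $\omega=\hat a\hat d+\hat b\hat c$. The algebra is extended by inverses $\omega^{-1}$ and $\hat d^{-1}$. The functions considered are formal power series, on which the action is taken term by term. $s14o$ is the dual Hopf algebra generated by $\tilde A,\tilde B,X^+,X^-$ with $\tilde A$ central, $[\tilde B,X^\pm]=\pm2X^\pm$, $[X^+,X^-]=\tilde B$, $K=(-1)^{\tilde A}$ (with $K^2=1$), coproduct $\delta(\tilde A)=\tilde A\otimes1+1\otimes\tilde A$, $\delta(\tilde B)=\tilde B\otimes1+1\otimes\tilde B$, $\delta(X^\pm)=X^\pm\otimes K+1\otimes X^\pm$, $\delta(K)=K\otimes K$, counit zero on $\tilde A,\tilde B,X^\pm$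 and $1$ on $K$, antipode $\gamma(\tilde A)=-\tilde A$, $\gamma(\tilde B)=-\tilde B$, $\gamma(X^\pm)=-X^\pm K$, $\gamma(K)=K$. The pairing with $S14o$ on the matrix $T$ of generators is: $\langle\tilde A,T\rangle=\mathrm{diag}(1,1)$, $\langle\tilde B,T\rangle=\mathrm{diag}(1,-1)$, $\langle X^+,T\rangle=\begin{pmatrix}0&1\\0&0\end{pmatrix}$, $\langle X^-,T\rangle=\begin{pmatrix}0&0\\1&0\end{pmatrix}$, $\langle K,T\rangle=-\mathrm{diag}(1,1)$, extended by $\langle u,fg\rangle=\langle\delta(u),f\otimes g\rangle$ and $\langle uv,f\rangle=\langle u\otimes v,\delta(f)\rangle$. The left action is $\pi_L(Z)f=\langle\gamma(Z),f_{(1)}\rangle f_{(2)}$ (Sweedler notation), which satisfies $\pi_L(Z)(fg)=(\pi_L(Z_{(2)})f)(\pi_L(Z_{(1)})g)$; it is extended to negative powers of $\hat d$ and $\omega$ by this product rule together with $\pi_L(Z)1=\varepsilon(Z)1$. On generators: $\pi_L(\tilde A)$ is $-1$ on $\hat a,\hat b,\hat c,\hat d$; $\pi_L(\tilde B)$ maps $\hat a,\hat b,\hat c,\hat d$ to $-\hat a,-\hat b,\hat c,\hat d$; $\pi_L(X^+)$ maps $\hat a\mapsto\hat c$, $\hat b\mapsto\hat d$, $\hat c,\hat d\mapsto0$; $\pi_L(X^-)$ maps $\hat c\mapsto\hat a$, $\hat d\mapsto\hat b$, $\hat a,\hat b\mapsto0$. In the formulas for $X^+$ at $\ell=0$ the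 right-hand side is $0$.
   Formalization: Irreducible is taken to mean having no proper nonzero invariant subspace closed in the formal power series topology (quotient topology on C/E), since the finite sums of the u_l always give a proper invariant subspace that is not closed. *)

theory Defs
  imports "HOL-Analysis.Abstract_Topology"
    "HOL-Computational_Algebra.Formal_Power_Series"
    "HOL-Library.Poly_Mapping"
begin

section \<open>Complex algebras given by generators and relations\<close>

text \<open>
  With concatenation of lists as monoid operation, the ring
  \<open>'g list \<Rightarrow>\<^sub>0 complex\<close> with its convolution product is the free unital associative
  complex algebra on \<open>'g\<close>.
\<close>

instantiation list :: (type) monoid_add
begin
definition zero_list :: "'a list" where "zero_list = []"
definition plus_list :: "'a list \<Rightarrow> 'a list \<Rightarrow> 'a list" where "plus_list = append"
instance by standard (simp_all add: zero_list_def plus_list_def)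
end

type_synonym 'g free = "'g list \<Rightarrow>\<^sub>0 complex"

abbreviation fgen :: "'g \<Rightarrow> 'g free" where
  "fgen g \<equiv> Poly_Mapping.single [g] 1"

abbreviation fscalar :: "complex \<Rightarrow> 'g free" where
  "fscalar c \<equiv> Poly_Mapping.single [] c"

inductive_set two_sided_ideal :: "'r::ring_1 set \<Rightarrow> 'r set" for R where
  zero: "0 \<in> two_sided_ideal R"
| rel: "r \<in> R \<Longrightarrow> p * r * q \<in> two_sided_ideal R"
| add: "x \<in> two_sided_ideal R \<Longrightarrow> y \<in> two_sided_ideal R \<Longrightarrow> x + y \<in> two_sided_ideal R"

lemma two_sided_ideal_mult_left: "x \<in> two_sided_ideal R \<Longrightarrow> s * x \<in> two_sided_ideal R"
proof (induction rule: two_sided_ideal.induct)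
  case (rel r p q)
  then have "(s * p) * r * q \<in> two_sided_ideal R" by (rule two_sided_ideal.rel)
  then show ?case by (simp add: mult.assoc)
qed (auto simp: distrib_left intro: two_sided_ideal.intros)

lemma two_sided_ideal_mult_right: "x \<in> two_sided_ideal R \<Longrightarrow> x * s \<in> two_sided_ideal R"
proof (induction rule: two_sided_ideal.induct)
  case (rel r p q)
  then have "p * r * (q * s) \<in> two_sided_ideal R" by (rule two_sided_ideal.rel)
  then show ?case by (simp add: mult.assoc)
qed (auto simp: distrib_right intro: two_sided_ideal.intros)

lemma two_sided_ideal_uminus: "x \<in> two_sided_ideal R \<Longrightarrow> - x \<in> two_sided_ideal R"
  using two_sided_ideal_mult_left[of x R "-1"] by simp

lemma two_sided_ideal_diff:
  "x \<in> two_sided_ideal R \<Longrightarrow> y \<in> two_sided_ideal R \<Longrightarrow> x - y \<in> two_sided_ideal R"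
  using two_sided_ideal.add[OF _ two_sided_ideal_uminus] by fastforce

text \<open>
  The relators are attached to the type of generators, so that one quotient type
  \<open>'g alg\<close> covers both algebras needed below.  A relation \<open>x = y\<close> is entered as \<open>x - y\<close>.
\<close>

class presented =
  fixes relators :: "('a list \<Rightarrow>\<^sub>0 complex) set"

quotient_type (overloaded) 'g alg = "'g::presented list \<Rightarrow>\<^sub>0 complex" /
  "\<lambda>x y. x - y \<in> two_sided_ideal (relators :: ('g list \<Rightarrow>\<^sub>0 complex) set)"
proof (rule equivpI)
  show "reflp (\<lambda>x y::'g free. x - y \<in> two_sided_ideal relators)"
    by (simp add: reflpI two_sided_ideal.zero)
  show "symp (\<lambda>x y::'g free. x - y \<in> two_sided_ideal relators)"
    using two_sided_ideal_uminus by (fastforce intro: sympI)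
  show "transp (\<lambda>x y::'g free. x - y \<in> two_sided_ideal relators)"
    using two_sided_ideal.add by (fastforce intro: transpI)
qed

instantiation alg :: (presented) "{ring, monoid_mult}"
begin
lift_definition zero_alg :: "'a alg" is 0 .
lift_definition one_alg :: "'a alg" is 1 .
lift_definition plus_alg :: "'a alg \<Rightarrow> 'a alg \<Rightarrow> 'a alg" is "(+)"
  using two_sided_ideal.add by (fastforce simp: algebra_simps)
lift_definition minus_alg :: "'a alg \<Rightarrow> 'a alg \<Rightarrow> 'a alg" is "(-)"
  using two_sided_ideal_diff by (fastforce simp: algebra_simps)
lift_definition uminus_alg :: "'a alg \<Rightarrow> 'a alg" is uminus
  using two_sided_ideal_uminus by fastforce
lift_definition times_alg :: "'a alg \<Rightarrow> 'a alg \<Rightarrow> 'a alg" is "(*)"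
proof -
  fix x x' y y' :: "'a free"
  assume "x - x' \<in> two_sided_ideal relators" "y - y' \<in> two_sided_ideal relators"
  then have "(x - x') * y + x' * (y - y') \<in> two_sided_ideal relators"
    by (intro two_sided_ideal.add two_sided_ideal_mult_left two_sided_ideal_mult_right)
  then show "x * y - x' * y' \<in> two_sided_ideal relators"
    by (simp add: algebra_simps)
qed
instance
  by standard (transfer; simp add: algebra_simps two_sided_ideal.zero)+
end

lift_definition alg_scale :: "complex \<Rightarrow> 'g::presented alg \<Rightarrow> 'g alg" (infixr \<open>*\<^sub>C\<close> 75)
  is "\<lambda>c x. fscalar c * x"
  using two_sided_ideal_mult_left by (fastforce simp flip: right_diff_distrib)

lift_definition monom :: "'g list \<Rightarrow> 'g::presented alg"
  is "\<lambda>w. Poly_Mapping.single w 1" .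

lemma fscalar_one: "fscalar 1 = 1"
  by (metis single_one zero_list_def)

lemma fscalar_mult: "fscalar c * fscalar d = fscalar (c * d)"
  by (simp add: mult_single plus_list_def)

global_interpretation alg_vs: vector_space alg_scale
proof
  fix c d :: complex and x y :: "'a alg"
  show "c *\<^sub>C (x + y) = c *\<^sub>C x + c *\<^sub>C y"
    by transfer (simp add: distrib_left two_sided_ideal.zero)
  show "(c + d) *\<^sub>C x = c *\<^sub>C x + d *\<^sub>C x"
    by transfer (simp add: single_add distrib_right two_sided_ideal.zero)
  show "c *\<^sub>C d *\<^sub>C x = (c * d) *\<^sub>C x"
    by transfer (simp add: fscalar_mult two_sided_ideal.zero flip: mult.assoc)
  show "1 *\<^sub>C x = x"
    by transfer (simp add: fscalar_one two_sided_ideal.zero)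
qed


section \<open>The two algebras\<close>

datatype idx = I1 | I2

text \<open>
  \<open>Tgen i j\<close> are the entries of the matrix of generators of S14o; \<open>Dinv\<close> and \<open>Winv\<close> are the
  adjoined inverses of \<open>d\<close> and \<open>\<omega>\<close>.
\<close>

datatype fun_gen = Tgen idx idx | Dinv | Winv

instantiation fun_gen :: presented
begin
definition relators_fun_gen :: "(fun_gen list \<Rightarrow>\<^sub>0 complex) set" where
  "relators_fun_gen =
    (let a = fgen (Tgen I1 I1); b = fgen (Tgen I1 I2); c = fgen (Tgen I2 I1); d = fgen (Tgen I2 I2);
         di = fgen Dinv; wi = fgen Winv; w = a * d + b * c
     in {b * a + a * b, c * a + a * c, d * a - a * d,
         c * b - b * c, b * d + d * b, c * d + d * c,
         d * di - 1, di * d - 1, w * wi - 1, wi * w - 1})"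
instance ..
end

type_synonym S14o_ext = "fun_gen alg"

datatype hopf_gen = gA | gB | gXp | gXm | gK

text \<open>
  The relation \<open>K = (-1)\<^sup>A\<close> is not polynomial.  Its algebraic consequences (\<open>K\<close> central,
  \<open>K\<^sup>2 = 1\<close>) are imposed here; in representations it is imposed on the
  eigenvectors of \<open>A\<close> with integer eigenvalue (see \<open>representation\<close> below).
\<close>

instantiation hopf_gen :: presented
begin
definition relators_hopf_gen :: "(hopf_gen list \<Rightarrow>\<^sub>0 complex) set" where
  "relators_hopf_gen =
    (let a = fgen gA; b = fgen gB; xp = fgen gXp; xm = fgen gXm; k = fgen gK
     in {a * fgen g - fgen g * a | g. True} \<union> {k * fgen g - fgen g * k | g. True} \<union>
        {k * k - 1,
         b * xp - xp * b - fscalar 2 * xp, b * xm - xm * b + fscalar 2 * xm,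
         xp * xm - xm * xp - b})"
instance ..
end

type_synonym s14o = "hopf_gen alg"


section \<open>Hopf structure and pairing\<close>

text \<open>
  All structure maps are given on words in the generators.  Each coproduct is a sum of
  elementary tensors of words with coefficient 1 and is encoded as the list of its summands;
  the antipode of a word is a scalar multiple of a word.
\<close>

fun cop_gen :: "hopf_gen \<Rightarrow> (hopf_gen list \<times> hopf_gen list) list" where
  "cop_gen gA = [([gA], []), ([], [gA])]"
| "cop_gen gB = [([gB], []), ([], [gB])]"
| "cop_gen gXp = [([gXp], [gK]), ([], [gXp])]"
| "cop_gen gXm = [([gXm], [gK]), ([], [gXm])]"
| "cop_gen gK = [([gK], [gK])]"

fun cop :: "hopf_gen list \<Rightarrow> (hopf_gen list \<times> hopf_gen list) list" where
  "cop [] = [([], [])]"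
| "cop (z # zs) = [(p @ p', q @ q'). (p, q) \<leftarrow> cop_gen z, (p', q') \<leftarrow> cop zs]"

definition counit :: "hopf_gen list \<Rightarrow> complex" where
  "counit zs = (\<Prod>z\<leftarrow>zs. if z = gK then 1 else 0)"

fun antipode_gen :: "hopf_gen \<Rightarrow> complex \<times> hopf_gen list" where
  "antipode_gen gA = (-1, [gA])"
| "antipode_gen gB = (-1, [gB])"
| "antipode_gen gXp = (-1, [gXp, gK])"
| "antipode_gen gXm = (-1, [gXm, gK])"
| "antipode_gen gK = (1, [gK])"

fun antipode :: "hopf_gen list \<Rightarrow> complex \<times> hopf_gen list" where
  "antipode [] = (1, [])"
| "antipode (z # zs) =
    (case antipode_gen z of (c, p) \<Rightarrow> case antipode zs of (d, q) \<Rightarrow> (c * d, q @ p))"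

type_synonym mat_word = "(idx \<times> idx) list"

fun mat_cop :: "mat_word \<Rightarrow> (mat_word \<times> mat_word) list" where
  "mat_cop [] = [([], [])]"
| "mat_cop ((i, j) # w) = [((i, k) # f, (k, j) # g). k \<leftarrow> [I1, I2], (f, g) \<leftarrow> mat_cop w]"

definition mat_counit :: "mat_word \<Rightarrow> complex" where
  "mat_counit w = (\<Prod>(i, j)\<leftarrow>w. if i = j then 1 else 0)"

fun pair_gen :: "hopf_gen \<Rightarrow> idx \<times> idx \<Rightarrow> complex" where
  "pair_gen gA (i, j) = (if i = j then 1 else 0)"
| "pair_gen gB (i, j) = (if i = j then (if i = I1 then 1 else -1) else 0)"
| "pair_gen gXp (i, j) = (if i = I1 \<and> j = I2 then 1 else 0)"
| "pair_gen gXm (i, j) = (if i = I2 \<and> j = I1 then 1 else 0)"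
| "pair_gen gK (i, j) = (if i = j then -1 else 0)"

lemma length_cop_gen:
  "(p, q) \<in> set (cop_gen z) \<Longrightarrow> length p \<le> 1 \<and> length q \<le> 1"
  by (cases z) auto

function pair :: "hopf_gen list \<Rightarrow> mat_word \<Rightarrow> complex" where
  "pair [] w = mat_counit w"
| "pair [z] [] = counit [z]"
| "pair [z] [t] = pair_gen z t"
| "pair [z] (t # t' # w) = (\<Sum>(p, q)\<leftarrow>cop_gen z. pair p [t] * pair q (t' # w))"
| "pair (z # z' # zs) w = (\<Sum>(f, g)\<leftarrow>mat_cop w. pair [z] f * pair (z' # zs) g)"
  by pat_completeness auto
termination
  by (relation "measures [\<lambda>(z, w). length z, \<lambda>(z, w). length w]")
     (auto dest: length_cop_gen simp: le_Suc_eq)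


section \<open>The left action\<close>

abbreviation mat_monom :: "mat_word \<Rightarrow> S14o_ext" where
  "mat_monom w \<equiv> monom (map (\<lambda>(i, j). Tgen i j) w)"

text \<open>
  \<open>\<langle>\<gamma>(Z), f\<^sub>1\<rangle> f\<^sub>2\<close> for words \<open>Z\<close> and \<open>f\<close>.
\<close>

definition left_action_word :: "hopf_gen list \<Rightarrow> mat_word \<Rightarrow> S14o_ext" where
  "left_action_word zs w =
    (case antipode zs of (c, zs') \<Rightarrow> \<Sum>(f, g)\<leftarrow>mat_cop w. (c * pair zs' f) *\<^sub>C mat_monom g)"

definition is_left_action :: "(s14o \<Rightarrow> S14o_ext \<Rightarrow> S14o_ext) \<Rightarrow> bool" where
  "is_left_action \<pi> \<longleftrightarrow>
    (\<forall>Z. Vector_Spaces.linear alg_scale alg_scale (\<pi> Z)) \<and>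
    (\<forall>x. Vector_Spaces.linear alg_scale alg_scale (\<lambda>Z. \<pi> Z x)) \<and>
    (\<forall>zs w. \<pi> (monom zs) (mat_monom w) = left_action_word zs w) \<and>
    (\<forall>zs x y. \<pi> (monom zs) (x * y) =
       (\<Sum>(p, q)\<leftarrow>cop zs. \<pi> (monom q) x * \<pi> (monom p) y)) \<and>
    (\<forall>zs. \<pi> (monom zs) 1 = counit zs *\<^sub>C 1)"

definition piL :: "s14o \<Rightarrow> S14o_ext \<Rightarrow> S14o_ext" where
  "piL = (THE \<pi>. is_left_action \<pi>)"


section \<open>Representations of s14o\<close>

text \<open>
  Representation spaces are complex vector spaces with a topology, given by explicit carriers
  so that invariant subspaces and quotients by them are again of this form.
\<close>

record 'v rep =
  vcarrier :: "'v set"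
  vzero :: 'v
  vadd :: "'v \<Rightarrow> 'v \<Rightarrow> 'v"
  vscale :: "complex \<Rightarrow> 'v \<Rightarrow> 'v"
  vtop :: "'v topology"
  act :: "s14o \<Rightarrow> 'v \<Rightarrow> 'v"

definition vspace :: "('v, 'm) rep_scheme \<Rightarrow> bool" where
  "vspace V \<longleftrightarrow>
    vzero V \<in> vcarrier V \<and> topspace (vtop V) = vcarrier V \<and>
    (\<forall>x\<in>vcarrier V. \<forall>y\<in>vcarrier V. vadd V x y \<in> vcarrier V \<and> vadd V x y = vadd V y x) \<and>
    (\<forall>x\<in>vcarrier V. \<forall>y\<in>vcarrier V. \<forall>z\<in>vcarrier V.
       vadd V (vadd V x y) z = vadd V x (vadd V y z)) \<and>
    (\<forall>x\<in>vcarrier V. vadd V (vzero V) x = x \<and> (\<exists>y\<in>vcarrier V. vadd V x y = vzero V)) \<and>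
    (\<forall>c. \<forall>x\<in>vcarrier V. vscale V c x \<in> vcarrier V) \<and>
    (\<forall>c. \<forall>x\<in>vcarrier V. \<forall>y\<in>vcarrier V.
       vscale V c (vadd V x y) = vadd V (vscale V c x) (vscale V c y)) \<and>
    (\<forall>c d. \<forall>x\<in>vcarrier V.
       vscale V (c + d) x = vadd V (vscale V c x) (vscale V d x) \<and>
       vscale V (c * d) x = vscale V c (vscale V d x)) \<and>
    (\<forall>x\<in>vcarrier V. vscale V 1 x = x)"

text \<open>The last clause is the relation \<open>K = (-1)\<^sup>A\<close>.\<close>

definition representation :: "('v, 'm) rep_scheme \<Rightarrow> bool" where
  "representation V \<longleftrightarrow> vspace V \<and>
    (\<forall>Z. \<forall>x\<in>vcarrier V. act V Z x \<in> vcarrier V) \<and>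
    (\<forall>Z. \<forall>x\<in>vcarrier V. \<forall>y\<in>vcarrier V. act V Z (vadd V x y) = vadd V (act V Z x) (act V Z y)) \<and>
    (\<forall>Z c. \<forall>x\<in>vcarrier V. act V Z (vscale V c x) = vscale V c (act V Z x)) \<and>
    (\<forall>Z Z'. \<forall>x\<in>vcarrier V. act V (Z + Z') x = vadd V (act V Z x) (act V Z' x)) \<and>
    (\<forall>c Z. \<forall>x\<in>vcarrier V. act V (c *\<^sub>C Z) x = vscale V c (act V Z x)) \<and>
    (\<forall>x\<in>vcarrier V. act V 1 x = x) \<and>
    (\<forall>Z Z'. \<forall>x\<in>vcarrier V. act V (Z * Z') x = act V Z (act V Z' x)) \<and>
    (\<forall>n::int. \<forall>x\<in>vcarrier V. act V (monom [gA]) x = vscale V (of_int n) x \<longrightarrow>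
       act V (monom [gK]) x = vscale V (if even n then 1 else -1) x)"

definition subspace_of :: "('v, 'm) rep_scheme \<Rightarrow> 'v set \<Rightarrow> bool" where
  "subspace_of V W \<longleftrightarrow> W \<subseteq> vcarrier V \<and> vzero V \<in> W \<and>
    (\<forall>x\<in>W. \<forall>y\<in>W. vadd V x y \<in> W) \<and> (\<forall>c. \<forall>x\<in>W. vscale V c x \<in> W)"

definition invariant_subspace :: "('v, 'm) rep_scheme \<Rightarrow> 'v set \<Rightarrow> bool" where
  "invariant_subspace V W \<longleftrightarrow> subspace_of V W \<and> (\<forall>Z. \<forall>x\<in>W. act V Z x \<in> W)"

definition infinite_dimensional :: "('v, 'm) rep_scheme \<Rightarrow> bool" where
  "infinite_dimensional V \<longleftrightarrow>
    \<not> (\<exists>S. finite S \<and> S \<subseteq> vcarrier V \<and> (\<forall>W. subspace_of V W \<and> S \<subseteq> W \<longrightarrow> W = vcarrier V))"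

text \<open>
  As usual for spaces of formal series, (ir)reducibility refers to closed invariant subspaces:
  the finite sums always form a proper, dense, invariant subspace.  For finite-dimensional
  subspaces of \<open>complex fps\<close> the closedness condition is vacuous.
\<close>

definition reducible :: "('v, 'm) rep_scheme \<Rightarrow> bool" where
  "reducible V \<longleftrightarrow> representation V \<and>
    (\<exists>W. invariant_subspace V W \<and> closedin (vtop V) W \<and> W \<noteq> {vzero V} \<and> W \<noteq> vcarrier V)"

definition irreducible_rep :: "('v, 'm) rep_scheme \<Rightarrow> bool" where
  "irreducible_rep V \<longleftrightarrow> representation V \<and> vcarrier V \<noteq> {vzero V} \<and>
    (\<forall>W. invariant_subspace V W \<and> closedin (vtop V) W \<longrightarrow> W = {vzero V} \<or> W = vcarrier V)"

definition highest_weight_vector ::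
  "('v, 'm) rep_scheme \<Rightarrow> complex \<Rightarrow> complex \<Rightarrow> 'v \<Rightarrow> bool" where
  "highest_weight_vector V \<alpha> \<beta> x \<longleftrightarrow> x \<in> vcarrier V \<and> x \<noteq> vzero V \<and>
    act V (monom [gA]) x = vscale V \<alpha> x \<and> act V (monom [gB]) x = vscale V \<beta> x \<and>
    act V (monom [gXp]) x = vzero V"

definition subrep :: "'v rep \<Rightarrow> 'v set \<Rightarrow> 'v rep" where
  "subrep V W = V\<lparr>vcarrier := W, vtop := subtopology (vtop V) W\<rparr>"

definition vcoset :: "'v rep \<Rightarrow> 'v set \<Rightarrow> 'v \<Rightarrow> 'v set" where
  "vcoset V W x = vadd V x ` W"

definition quotient_topology :: "'v topology \<Rightarrow> ('v \<Rightarrow> 'w) \<Rightarrow> 'w topology" where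
  "quotient_topology X q =
    topology (\<lambda>U. U \<subseteq> q ` topspace X \<and> openin X {x \<in> topspace X. q x \<in> U})"

definition quotient_rep :: "'v rep \<Rightarrow> 'v set \<Rightarrow> 'v set rep" where
  "quotient_rep V W = \<lparr>
    vcarrier = vcoset V W ` vcarrier V,
    vzero = W,
    vadd = (\<lambda>S S'. {vadd V x y | x y. x \<in> S \<and> y \<in> S'}),
    vscale = (\<lambda>c S. {vadd V (vscale V c x) w | x w. x \<in> S \<and> w \<in> W}),
    vtop = quotient_topology (vtop V) (vcoset V W),
    act = (\<lambda>Z S. {vadd V (act V Z x) w | x w. x \<in> S \<and> w \<in> W})\<rparr>"


section \<open>The representation space of formal power series\<close>

definition int_pow :: "'r::monoid_mult \<Rightarrow> 'r \<Rightarrow> int \<Rightarrow> 'r" where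
  "int_pow x xinv n = (if n \<ge> 0 then x ^ nat n else xinv ^ nat (- n))"

abbreviation bhat :: S14o_ext where "bhat \<equiv> monom [Tgen I1 I2]"
abbreviation dhat :: S14o_ext where "dhat \<equiv> monom [Tgen I2 I2]"
abbreviation dhat_inv :: S14o_ext where "dhat_inv \<equiv> monom [Dinv]"

definition omega :: S14o_ext where
  "omega = monom [Tgen I1 I1] * dhat + bhat * monom [Tgen I2 I1]"

abbreviation omega_inv :: S14o_ext where "omega_inv \<equiv> monom [Winv]"

definition u_vec :: "int \<Rightarrow> int \<Rightarrow> nat \<Rightarrow> S14o_ext" where
  "u_vec \<nu> \<rho> l =
    bhat ^ l * int_pow dhat dhat_inv (\<nu> - int l) * int_pow omega omega_inv ((\<rho> - \<nu>) div 2)"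

definition v_vec :: "int \<Rightarrow> int \<Rightarrow> nat \<Rightarrow> S14o_ext" where
  "v_vec \<nu> \<rho> l =
    (bhat * dhat_inv) ^ l * int_pow dhat dhat_inv \<nu> * int_pow omega omega_inv ((\<rho> - \<nu>) div 2)"

text \<open>
  A formal series \<open>\<Sum>\<mu>\<^sub>l u\<^sub>l\<close> is represented by its coefficient sequence, as an element of
  \<open>complex fps\<close>, of which only the vector space structure and the (formal power series)
  topology are used.  \<open>series \<nu> \<rho>\<close> embeds the span of the \<open>u\<^sub>l\<close> into this space.
\<close>

definition fps_scale :: "complex \<Rightarrow> complex fps \<Rightarrow> complex fps" where
  "fps_scale c f = fps_const c * f"

global_interpretation fps_vs: vector_space fps_scale
  by standard
    (simp_all add: fps_scale_def algebra_simps flip: fps_const_add fps_const_mult)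

definition series :: "int \<Rightarrow> int \<Rightarrow> S14o_ext \<Rightarrow> complex fps" where
  "series \<nu> \<rho> x = Abs_fps (\<lambda>k. alg_vs.representation (range (u_vec \<nu> \<rho>)) x (u_vec \<nu> \<rho> k))"

definition termwise :: "int \<Rightarrow> int \<Rightarrow> s14o \<Rightarrow> complex fps \<Rightarrow> nat \<Rightarrow> complex fps" where
  "termwise \<nu> \<rho> Z f l = fps_scale (fps_nth f l) (series \<nu> \<rho> (piL Z (u_vec \<nu> \<rho> l)))"

definition C_rep :: "int \<Rightarrow> int \<Rightarrow> complex fps rep" where
  "C_rep \<nu> \<rho> = \<lparr>
    vcarrier = UNIV, vzero = 0, vadd = (+), vscale = fps_scale, vtop = euclidean,
    act = (\<lambda>Z f. suminf (termwise \<nu> \<rho> Z f))\<rparr>"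

definition E_space :: "int \<Rightarrow> int \<Rightarrow> complex fps set" where
  "E_space \<nu> \<rho> = fps_vs.span {series \<nu> \<rho> (u_vec \<nu> \<rho> l) | l. int l \<le> \<nu>}"

end

theory Submission
  imports Defs "HOL-Analysis.Product_Vector"
begin

text \<open>
  By the product rule a generator acts on the function algebra as a derivation (\<open>A\<close>, \<open>B\<close>), as a
  derivation twisted by the sign automorphism \<open>K\<close> (\<open>X\<^sup>\<plusminus>\<close>), or as \<open>K\<close> itself.  Such maps exist
  because a twisted derivation is an algebra homomorphism into triangular matrices, so that only
  the defining relations have to be checked; and they are determined by their values on
  \<open>a, b, c, d\<close>, which yields the relations of s14o as operator identities.  The adjoined inverses
  leave no freedom either: in \<open>0 = \<pi>(Z)(x x\<inverse>) - \<epsilon>(Z)\<close> the leading term of the coproduct of \<open>Z\<close>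
  isolates \<open>\<pi>(Z) x\<inverse>\<close>.

  On coefficient sequences the generators act by banded matrices, so the termwise action always
  converges.  Since the \<open>u\<^sub>l\<close> have distinct weights under \<open>B\<close>, a closed invariant subspace contains
  \<open>u\<^sub>l\<close> as soon as it contains a series whose \<open>l\<close>-th coefficient is nonzero: the products
  \<open>\<Prod> (B - \<beta>\<^sub>k) / (\<beta>\<^sub>l - \<beta>\<^sub>k)\<close> over the weights \<open>\<beta>\<^sub>k\<close> with \<open>k < N\<close>, \<open>k \<noteq> l\<close> converge to the projection
  onto \<open>u\<^sub>l\<close>.  The operators \<open>X\<^sup>\<plusminus>\<close> then reach all other \<open>u\<^sub>k\<close>, except that \<open>X\<^sup>-\<close> cannot pass from
  \<open>u\<^sub>\<nu>\<close> to \<open>u\<^bsub>\<nu>+1\<^esub>\<close>.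
\<close>

section \<open>Actions of presented algebras\<close>

text \<open>A word outside the support is inserted by adding a \<open>single\<close>, and zero is
  itself a \<open>single\<close> with coefficient 0.\<close>

lemma free_induct [case_names single add]:
  fixes p :: "'g free"
  assumes "\<And>w c. P (Poly_Mapping.single w c)" and "\<And>p q. P p \<Longrightarrow> P q \<Longrightarrow> P (p + q)"
  shows "P p"
proof (induction p rule: update_induct)
  case const
  show ?case using assms(1)[of undefined 0] by simp
next
  case (update f a b)
  have "Poly_Mapping.update a b f = Poly_Mapping.single a b + f"
    using update(1)
    by (intro poly_mapping_eqI) (auto simp: lookup_update lookup_add lookup_single in_keys_iff)
  then show ?case using assms update by metis
qed

text \<open>The universal property of the free algebra: linear operators chosen for the generators
  extend to a module structure. With \<open>foldr\<close> the last letter acts first, so words act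
  as products of operators.\<close>

locale generator_ops = vector_space scale
  for scale :: "complex \<Rightarrow> 'v::ab_group_add \<Rightarrow> 'v" +
  fixes L :: "'g \<Rightarrow> 'v \<Rightarrow> 'v"
  assumes L_add: "L g (x + y) = L g x + L g y"
    and L_scale: "L g (scale c x) = scale c (L g x)"
begin

abbreviation act_word :: "'g list \<Rightarrow> 'v \<Rightarrow> 'v" where
  "act_word w x \<equiv> foldr L w x"

lemma act_word_add: "act_word w (x + y) = act_word w x + act_word w y"
  by (induction w) (simp_all add: L_add)

lemma act_word_scale: "act_word w (scale c x) = scale c (act_word w x)"
  by (induction w) (simp_all add: L_scale)

definition act_free :: "'g free \<Rightarrow> 'v \<Rightarrow> 'v" where
  "act_free p x = (\<Sum>w\<in>Poly_Mapping.keys p. scale (Poly_Mapping.lookup p w) (act_word w x))"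

lemma act_free_single [simp]: "act_free (Poly_Mapping.single w c) x = scale c (act_word w x)"
  by (simp add: act_free_def)

lemma act_free_plus: "act_free (p + q) x = act_free p x + act_free q x"
  unfolding act_free_def
  by (rule setsum_keys_plus_distrib) (simp_all add: scale_left_distrib)

lemma act_free_zero [simp]: "act_free 0 x = 0"
  by (simp add: act_free_def)

lemma act_free_minus: "act_free (p - q) x = act_free p x - act_free q x"
  using act_free_plus[of "p - q" q x] by simp

lemma act_free_one [simp]: "act_free 1 x = x"
  by (simp add: act_free_single flip: fscalar_one)

lemma act_free_add: "act_free p (x + y) = act_free p x + act_free p y"
  by (simp add: act_free_def act_word_add scale_right_distrib sum.distrib)

lemma act_free_scale: "act_free p (scale c x) = scale c (act_free p x)"
  by (simp add: act_free_def act_word_scale scale_sum_right mult.commute)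

lemma act_free_mult: "act_free (p * q) x = act_free p (act_free q x)"
proof (induction p rule: free_induct)
  case (single w c)
  show ?case
  proof (induction q rule: free_induct)
    case (single w' c')
    show ?case by (simp add: mult_single plus_list_def act_word_scale)
  next
    case (add p q)
    then show ?case by (simp add: distrib_left act_free_plus act_free_add del: act_free_single)
  qed
next
  case (add p q)
  then show ?case by (simp add: distrib_right act_free_plus)
qed

lemma act_free_zero_right [simp]: "act_free p 0 = 0"
  using act_free_scale[of p 0 0] by simp

text \<open>In \<open>p * r * q\<close> the relator kills whatever \<open>q\<close> has produced,
  and \<open>p\<close> maps zero to zero.\<close>

lemma act_free_ideal:
  assumes "\<And>r x. r \<in> R \<Longrightarrow> act_free r x = 0" and "p \<in> two_sided_ideal R"
  shows "act_free p x = 0"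
  using assms(2) by induction (simp_all add: act_free_mult act_free_plus assms(1))

end

lemma abs_rep_alg [simp]: "abs_alg (rep_alg Z) = Z"
  by (rule Quotient3_abs_rep[OF Quotient3_alg])

lemma alg_cases [case_names abs, cases type: alg]:
  obtains p where "Z = abs_alg p"
  using abs_rep_alg by metis

locale presented_ops = generator_ops scale L
  for scale :: "complex \<Rightarrow> 'v::ab_group_add \<Rightarrow> 'v" and L :: "'g::presented \<Rightarrow> 'v \<Rightarrow> 'v" +
  assumes act_relator: "r \<in> relators \<Longrightarrow> act_free r x = 0"
begin

text \<open>Uses the chosen representative; \<open>act_alg_abs\<close> shows that every other one
  acts alike, as differences lie in the ideal.\<close>

definition act_alg :: "'g alg \<Rightarrow> 'v \<Rightarrow> 'v" where
  "act_alg Z x = act_free (rep_alg Z) x"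

lemma act_alg_abs: "act_alg (abs_alg p) x = act_free p x"
proof -
  have "rep_alg (abs_alg p) - p \<in> two_sided_ideal relators"
    using alg.abs_eq_iff[of "rep_alg (abs_alg p)" p] by simp
  then have "act_free (rep_alg (abs_alg p) - p) x = 0"
    by (rule act_free_ideal[rotated]) (rule act_relator)
  then show ?thesis by (simp add: act_alg_def act_free_minus)
qed

lemma act_alg_monom [simp]: "act_alg (monom w) x = act_word w x"
  by (simp add: monom_def act_alg_abs)

lemma act_alg_one [simp]: "act_alg 1 x = x"
  by (simp add: one_alg_def act_alg_abs)

lemma act_alg_plus: "act_alg (Z + Z') x = act_alg Z x + act_alg Z' x"
  by (cases Z; cases Z') (simp add: plus_alg.abs_eq act_alg_abs act_free_plus)

lemma act_alg_mult: "act_alg (Z * Z') x = act_alg Z (act_alg Z' x)"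
  by (cases Z; cases Z') (simp add: times_alg.abs_eq act_alg_abs act_free_mult)

lemma act_alg_scale_left: "act_alg (c *\<^sub>C Z) x = scale c (act_alg Z x)"
  by (cases Z) (simp add: alg_scale.abs_eq act_alg_abs act_free_mult)

lemma act_alg_add: "act_alg Z (x + y) = act_alg Z x + act_alg Z y"
  by (simp add: act_alg_def act_free_add)

lemma act_alg_scale: "act_alg Z (scale c x) = scale c (act_alg Z x)"
  by (simp add: act_alg_def act_free_scale)

end

section \<open>Words and scalars in presented algebras\<close>

lemma monom_abs: "monom w = abs_alg (Poly_Mapping.single w 1)"
  by (simp add: monom_def)

lemma monom_Nil: "monom [] = 1"
  by (simp add: monom_def one_alg_def fscalar_one)

lemma monom_append: "monom (v @ w) = monom v * monom w"
  by (simp add: monom_def times_alg.abs_eq mult_single plus_list_def)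

lemma monom_Cons: "monom (g # w) = monom [g] * monom w"
  using monom_append[of "[g]" w] by simp

lemma alg_induct [case_names monom add scale]:
  fixes x :: "'g::presented alg"
  assumes monom: "\<And>w. P (monom w)"
    and add: "\<And>x y. P x \<Longrightarrow> P y \<Longrightarrow> P (x + y)"
    and scale: "\<And>c x. P x \<Longrightarrow> P (c *\<^sub>C x)"
  shows "P x"
proof -
  have "P (abs_alg p)" for p
  proof (induction p rule: free_induct)
    case (single w c)
    have "abs_alg (Poly_Mapping.single w c) = c *\<^sub>C monom w"
      by (simp add: monom_def alg_scale.abs_eq mult_single plus_list_def)
    then show ?case using monom scale by metis
  next
    case (add p q)
    then show ?case using assms(2) by (metis plus_alg.abs_eq)
  qed
  from this[of "rep_alg x"] show ?thesis by simp
qed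

lemma alg_scale_mult_left: "(c *\<^sub>C x) * y = c *\<^sub>C (x * y)"
  by (cases x; cases y) (simp add: alg_scale.abs_eq times_alg.abs_eq mult.assoc)

lemma fscalar_commute: "fscalar c * p = p * fscalar c"
  by (induction p rule: free_induct)
    (simp_all add: mult_single plus_list_def mult.commute distrib_left distrib_right)

lemma alg_scale_mult_right: "x * (c *\<^sub>C y) = c *\<^sub>C (x * y)"
proof (cases x; cases y)
  fix p q
  assume "x = abs_alg p" "y = abs_alg q"
  moreover have "p * (fscalar c * q) = fscalar c * (p * q)"
    by (metis fscalar_commute mult.assoc)
  ultimately show ?thesis by (simp add: alg_scale.abs_eq times_alg.abs_eq)
qed

lemma relator_zero: "r \<in> relators \<Longrightarrow> abs_alg r = 0"
  unfolding zero_alg_def alg.abs_eq_iff using two_sided_ideal.rel[of r _ 1 1] by simp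

section \<open>The defining relations of S14o as equations\<close>

abbreviation ahat :: S14o_ext where "ahat \<equiv> monom [Tgen I1 I1]"
abbreviation chat :: S14o_ext where "chat \<equiv> monom [Tgen I2 I1]"

text \<open>The commutation relations are oriented as rewrite rules that sort products into the
  order a, d, b, c.\<close>

lemma S14o_relations:
  "bhat * ahat = - (ahat * bhat)" "chat * ahat = - (ahat * chat)" "dhat * ahat = ahat * dhat"
  "chat * bhat = bhat * chat" "bhat * dhat = - (dhat * bhat)" "chat * dhat = - (dhat * chat)"
  "dhat * dhat_inv = 1" "dhat_inv * dhat = 1" "omega * omega_inv = 1" "omega_inv * omega = 1"
proof -
  let ?a = "fgen (Tgen I1 I1)" and ?b = "fgen (Tgen I1 I2)"
  let ?c = "fgen (Tgen I2 I1)" and ?d = "fgen (Tgen I2 I2)"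
  let ?di = "fgen Dinv" and ?wi = "fgen Winv" and ?w = "?a * ?d + ?b * ?c"
  have rel: "\<forall>r\<in>{?b * ?a + ?a * ?b, ?c * ?a + ?a * ?c, ?d * ?a - ?a * ?d,
         ?c * ?b - ?b * ?c, ?b * ?d + ?d * ?b, ?c * ?d + ?d * ?c,
         ?d * ?di - 1, ?di * ?d - 1, ?w * ?wi - 1, ?wi * ?w - 1}. abs_alg r = 0"
    by (intro ballI relator_zero) (simp add: relators_fun_gen_def Let_def)
  have hom: "abs_alg (p + q) = abs_alg p + abs_alg q" "abs_alg (p - q) = abs_alg p - abs_alg q"
    "abs_alg (p * q) = abs_alg p * abs_alg q" "abs_alg (fgen g) = monom [g]" "abs_alg 1 = 1"
    for p q and g :: fun_gen
    by (simp_all add: monom_abs plus_alg.abs_eq minus_alg.abs_eq times_alg.abs_eq one_alg_def)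
  show
    "bhat * ahat = - (ahat * bhat)" "chat * ahat = - (ahat * chat)" "dhat * ahat = ahat * dhat"
    "chat * bhat = bhat * chat" "bhat * dhat = - (dhat * bhat)" "chat * dhat = - (dhat * chat)"
    "dhat * dhat_inv = 1" "dhat_inv * dhat = 1" "omega * omega_inv = 1" "omega_inv * omega = 1"
    using rel unfolding omega_def ball_simps hom eq_neg_iff_add_eq_0
    by (simp_all only: right_minus_eq)
qed

section \<open>A module over S14o on formal power series\<close>

text \<open>The quotient of the algebra by \<open>c = 0\<close>, \<open>a = d\<close>, \<open>d\<^sup>2 = 1\<close> still separates the powers of
  \<open>b\<close>; it acts on power series in \<open>X\<close> with \<open>b\<close> as multiplication by \<open>X\<close> and \<open>d\<close> as
  \<open>X \<mapsto> - X\<close>, so that \<open>u\<^sub>l\<close> sends \<open>1\<close> to \<open>X\<^sup>l\<close>.\<close>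

definition fps_alternate :: "complex fps \<Rightarrow> complex fps" where
  "fps_alternate f = Abs_fps (\<lambda>n. (-1) ^ n * fps_nth f n)"

fun model_op :: "fun_gen \<Rightarrow> complex fps \<Rightarrow> complex fps" where
  "model_op (Tgen I1 I1) f = fps_alternate f"
| "model_op (Tgen I1 I2) f = fps_X * f"
| "model_op (Tgen I2 I1) f = 0"
| "model_op (Tgen I2 I2) f = fps_alternate f"
| "model_op Dinv f = fps_alternate f"
| "model_op Winv f = f"

lemma fps_alternate_alternate [simp]: "fps_alternate (fps_alternate f) = f"
  by (simp add: fps_alternate_def fps_eq_iff flip: mult.assoc power_add)

lemma fps_alternate_X: "fps_alternate (fps_X * f) = - (fps_X * fps_alternate f)"
  by (auto simp: fps_alternate_def fps_eq_iff power_eq_if)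

global_interpretation model: generator_ops fps_scale model_op
proof
  fix g x y c
  show "model_op g (x + y) = model_op g x + model_op g y"
    by (cases "(g, x)" rule: model_op.cases)
      (simp_all add: fps_alternate_def fps_eq_iff algebra_simps)
  show "model_op g (fps_scale c x) = fps_scale c (model_op g x)"
    by (cases "(g, x)" rule: model_op.cases)
      (simp_all add: fps_alternate_def fps_eq_iff algebra_simps fps_scale_def)
qed

text \<open>Since c acts as 0 and a, d as the same involution, \<omega> acts as the identity, and so
  may its inverse. The relations of b with a and d reduce to \<open>fps_alternate_X\<close>.\<close>

global_interpretation model: presented_ops fps_scale model_op
proof
  fix r :: "fun_gen free" and x
  assume "r \<in> relators"
  then show "model.act_free r x = 0"
    by (auto simp: relators_fun_gen_def Let_def model.act_free_plus model.act_free_minus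
        model.act_free_mult fps_alternate_X distrib_left distrib_right)
qed

text \<open>Evaluation at the vector 1. It serves as coordinate map: on combinations of the
  \<open>u_vec \<nu> \<rho> l\<close> its l-th coefficient is the coordinate at that vector.\<close>

definition \<Phi> :: "S14o_ext \<Rightarrow> complex fps" where
  "\<Phi> x = model.act_alg x 1"

lemma \<Phi>_add: "\<Phi> (x + y) = \<Phi> x + \<Phi> y"
  and \<Phi>_scale: "\<Phi> (c *\<^sub>C x) = fps_scale c (\<Phi> x)"
  by (simp_all add: \<Phi>_def model.act_alg_plus model.act_alg_scale_left)

lemma model_power_fix:
  "model.act_alg x f = f \<Longrightarrow> model.act_alg (x ^ n) f = f"
  by (induction n) (simp_all add: model.act_alg_mult)

lemma model_bhat_power: "model.act_alg (bhat ^ n) f = fps_X ^ n * f"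
  by (induction n) (simp_all add: model.act_alg_mult mult.assoc)

lemma fps_alternate_1 [simp]: "fps_alternate 1 = 1"
  by (simp add: fps_alternate_def fps_eq_iff)

text \<open>Powers of d and \<omega> fix the vector 1, and \<open>bhat ^ l\<close> then multiplies
  it by \<open>fps_X ^ l\<close>.\<close>

lemma \<Phi>_u_vec: "\<Phi> (u_vec \<nu> \<rho> l) = fps_X ^ l"
proof -
  have "model.act_alg (int_pow omega omega_inv n) 1 = 1" for n
    by (auto simp: int_pow_def omega_def model.act_alg_plus model.act_alg_mult
        intro!: model_power_fix)
  moreover have "model.act_alg (int_pow dhat dhat_inv n) 1 = 1" for n
    by (auto simp: int_pow_def intro!: model_power_fix)
  ultimately show ?thesis
    by (simp add: \<Phi>_def u_vec_def model.act_alg_mult model_bhat_power)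
qed

lemma inj_u_vec: "inj (u_vec \<nu> \<rho>)"
proof (rule injI)
  fix l m
  assume "u_vec \<nu> \<rho> l = u_vec \<nu> \<rho> m"
  then have "fps_nth (fps_X ^ l :: complex fps) l = fps_nth (fps_X ^ m) l"
    by (metis \<Phi>_u_vec)
  then show "l = m" by (simp add: fps_X_power_nth split: if_splits)
qed

interpretation \<Phi>: Vector_Spaces.linear alg_scale fps_scale \<Phi>
  by unfold_locales (simp_all add: \<Phi>_add \<Phi>_scale)

lemma fps_nth_scale [simp]: "fps_nth (fps_scale c f) n = c * fps_nth f n"
  by (simp add: fps_scale_def)

text \<open>Applying \<Phi> to a vanishing combination and reading off coefficient l isolates the
  scalar at \<open>u_vec \<nu> \<rho> l\<close>.\<close>

lemma independent_u_vec: "alg_vs.independent (range (u_vec \<nu> \<rho>))"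
  unfolding alg_vs.independent_explicit_finite_subsets
proof (intro allI impI ballI)
  fix S c v
  assume S: "S \<subseteq> range (u_vec \<nu> \<rho>)" "finite S" and 0: "(\<Sum>v\<in>S. c v *\<^sub>C v) = 0" and v: "v \<in> S"
  then obtain l where l: "v = u_vec \<nu> \<rho> l" by auto
  have "c w * fps_nth (\<Phi> w) l = (if w = v then c w else 0)" if "w \<in> S" for w
    using S(1) that by (auto simp: l \<Phi>_u_vec fps_X_power_nth inj_eq[OF inj_u_vec])
  then have "fps_nth (\<Phi> (\<Sum>w\<in>S. c w *\<^sub>C w)) l = (\<Sum>w\<in>S. if w = v then c w else 0)"
    by (simp add: \<Phi>.sum \<Phi>_scale fps_sum_nth)
  then show "c v = 0" using S(2) v by (simp add: 0 \<Phi>.zero)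
qed

lemma series_eq_\<Phi>:
  assumes "x \<in> alg_vs.span (range (u_vec \<nu> \<rho>))"
  shows "series \<nu> \<rho> x = \<Phi> x"
proof -
  \<comment> \<open>Membership in the span is carried along because
    \<open>alg_vs.representation\<close> is additive only there.\<close>
  have "x \<in> alg_vs.span (range (u_vec \<nu> \<rho>)) \<and> series \<nu> \<rho> x = \<Phi> x"
    using assms
  proof (induction rule: alg_vs.span_induct_alt)
    case base
    show ?case by (simp add: alg_vs.span_zero series_def alg_vs.representation_zero \<Phi>.zero fps_eq_iff)
  next
    case (step c x y)
    then obtain l where l: "x = u_vec \<nu> \<rho> l" by auto
    have span: "x \<in> alg_vs.span (range (u_vec \<nu> \<rho>))" by (rule alg_vs.span_base[OF step(1)])
    have "alg_vs.representation (range (u_vec \<nu> \<rho>)) (c *\<^sub>C x + y) =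
        (\<lambda>b. c * (if b = x then 1 else 0) + alg_vs.representation (range (u_vec \<nu> \<rho>)) y b)"
      using span step by (simp add: alg_vs.representation_add alg_vs.representation_scale
          alg_vs.representation_basis independent_u_vec alg_vs.span_scale)
    then show ?case
      using step.IH span
      by (auto simp: alg_vs.span_add alg_vs.span_scale series_def fps_eq_iff \<Phi>.add \<Phi>.scale
          l \<Phi>_u_vec fps_X_power_nth inj_eq[OF inj_u_vec])
  qed
  then show ?thesis ..
qed

section \<open>Skew derivations of S14o\<close>

interpretation pairs: vector_space_prod "alg_scale :: complex \<Rightarrow> S14o_ext \<Rightarrow> S14o_ext" alg_scale ..

abbreviation pscale :: "complex \<Rightarrow> S14o_ext \<times> S14o_ext \<Rightarrow> S14o_ext \<times> S14o_ext" where
  "pscale \<equiv> pairs.scale"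

lemma pscale_simps [simp]:
  "fst (pscale c v) = c *\<^sub>C fst v" "snd (pscale c v) = c *\<^sub>C snd v"
  "pscale c (x, y) = (c *\<^sub>C x, c *\<^sub>C y)"
  by (simp_all add: pairs.scale_def)

lemmas alg_simps = alg_scale_mult_left alg_scale_mult_right mult.assoc distrib_left distrib_right
  alg_vs.scale_right_distrib alg_vs.scale_left_distrib

text \<open>
  A \<open>\<kappa>\<close>-skew derivation \<open>D\<close> is the upper right corner of an algebra homomorphism
  \<open>f \<mapsto> ((\<kappa> f, D f), (0, f))\<close> into triangular matrices; these act on pairs.  Here \<open>\<kappa>\<close>
  multiplies the generators \<open>T\<^sub>i\<^sub>j\<close> by the sign \<open>s\<close>, and \<open>D \<omega> = t \<omega>\<close>.
\<close>

locale skew_data =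
  fixes s t :: complex and \<delta> :: "idx \<Rightarrow> idx \<Rightarrow> S14o_ext"
  assumes s: "s * s = 1"
    and ba: "s *\<^sub>C (bhat * \<delta> I1 I1) + \<delta> I1 I2 * ahat + (s *\<^sub>C (ahat * \<delta> I1 I2) + \<delta> I1 I1 * bhat) = 0"
    and ca: "s *\<^sub>C (chat * \<delta> I1 I1) + \<delta> I2 I1 * ahat + (s *\<^sub>C (ahat * \<delta> I2 I1) + \<delta> I1 I1 * chat) = 0"
    and da: "s *\<^sub>C (dhat * \<delta> I1 I1) + \<delta> I2 I2 * ahat = s *\<^sub>C (ahat * \<delta> I2 I2) + \<delta> I1 I1 * dhat"
    and cb: "s *\<^sub>C (chat * \<delta> I1 I2) + \<delta> I2 I1 * bhat = s *\<^sub>C (bhat * \<delta> I2 I1) + \<delta> I1 I2 * chat"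
    and bd: "s *\<^sub>C (bhat * \<delta> I2 I2) + \<delta> I1 I2 * dhat + (s *\<^sub>C (dhat * \<delta> I1 I2) + \<delta> I2 I2 * bhat) = 0"
    and cd: "s *\<^sub>C (chat * \<delta> I2 I2) + \<delta> I2 I1 * dhat + (s *\<^sub>C (dhat * \<delta> I2 I1) + \<delta> I2 I2 * chat) = 0"
    and omega: "s *\<^sub>C (ahat * \<delta> I2 I2) + \<delta> I1 I1 * dhat + (s *\<^sub>C (bhat * \<delta> I2 I1) + \<delta> I1 I2 * chat)
      = t *\<^sub>C omega"
begin

fun gen_sign :: "fun_gen \<Rightarrow> complex" where
  "gen_sign (Tgen i j) = s"
| "gen_sign Dinv = s"
| "gen_sign Winv = 1"

text \<open>On the inverses the value is forced by applying D to \<open>d d^-1 = 1\<close> and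
  \<open>\<omega> \<omega>^-1 = 1\<close>, where \<kappa> multiplies d by \<open>s\<close> and fixes
  \<omega> because \<open>s * s = 1\<close>.\<close>

fun gen_val :: "fun_gen \<Rightarrow> S14o_ext" where
  "gen_val (Tgen i j) = \<delta> i j"
| "gen_val Dinv = - (s *\<^sub>C (dhat_inv * \<delta> I2 I2 * dhat_inv))"
| "gen_val Winv = - (t *\<^sub>C omega_inv)"

definition tri :: "fun_gen \<Rightarrow> S14o_ext \<times> S14o_ext \<Rightarrow> S14o_ext \<times> S14o_ext" where
  "tri g v = (gen_sign g *\<^sub>C (monom [g] * fst v) + gen_val g * snd v, monom [g] * snd v)"

sublocale generator_ops pscale tri
  by unfold_locales (auto simp: tri_def pairs.scale_def alg_simps mult_ac)

lemma tri_tri: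
  "tri g (tri h v) =
    ((gen_sign g * gen_sign h) *\<^sub>C (monom [g] * monom [h] * fst v) +
     (gen_sign g *\<^sub>C (monom [g] * gen_val h) + gen_val g * monom [h]) * snd v,
     monom [g] * monom [h] * snd v)"
  by (simp add: tri_def alg_simps)

lemma dhat_cancel [simp]: "dhat * (dhat_inv * x) = x" "dhat_inv * (dhat * x) = x"
  and omega_cancel [simp]: "omega * (omega_inv * x) = x" "omega_inv * (omega * x) = x"
  by (simp_all add: S14o_relations flip: mult.assoc)

lemma act_omega:
  "act_free (fgen (Tgen I1 I1) * fgen (Tgen I2 I2) + fgen (Tgen I1 I2) * fgen (Tgen I2 I1)) v =
    (omega * fst v + (t *\<^sub>C omega) * snd v, omega * snd v)"
proof -
  \<comment> \<open>Regroups by the two components of the pair, so that the coefficient of the lower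
    one matches the assumption \<open>omega\<close>.\<close>
  have "a * x + b * y + (c * x + d * y) = (a + c) * x + (b + d) * y" for a b c d x y :: S14o_ext
    by (simp add: algebra_simps)
  then show ?thesis
    by (simp add: act_free_plus act_free_mult tri_tri s omega) (simp add: omega_def algebra_simps)
qed

text \<open>On the diagonal the relators vanish because the algebra satisfies them and the signs
  enter as \<open>s * s\<close>; in the corner they vanish by \<open>ba\<close> to \<open>cd\<close>
  and the choice of \<open>gen_val\<close>.\<close>

sublocale presented_ops pscale tri
proof
  fix r :: "fun_gen free" and v
  assume r: "r \<in> relators"
  note simps = act_free_plus act_free_minus act_free_mult tri_tri s S14o_relations
    zero_prod_def act_omega
  show "act_free r v = 0"
    using r unfolding relators_fun_gen_def Let_def
  proof (elim insertE emptyE)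
    assume "r = fgen (Tgen I1 I2) * fgen (Tgen I1 I1) + fgen (Tgen I1 I1) * fgen (Tgen I1 I2)"
    then show ?thesis by (simp add: simps ba flip: distrib_right)
  next
    assume "r = fgen (Tgen I2 I1) * fgen (Tgen I1 I1) + fgen (Tgen I1 I1) * fgen (Tgen I2 I1)"
    then show ?thesis by (simp add: simps ca flip: distrib_right)
  next
    assume "r = fgen (Tgen I2 I2) * fgen (Tgen I1 I1) - fgen (Tgen I1 I1) * fgen (Tgen I2 I2)"
    then show ?thesis by (simp add: simps da)
  next
    assume "r = fgen (Tgen I2 I1) * fgen (Tgen I1 I2) - fgen (Tgen I1 I2) * fgen (Tgen I2 I1)"
    then show ?thesis by (simp add: simps cb)
  next
    assume "r = fgen (Tgen I1 I2) * fgen (Tgen I2 I2) + fgen (Tgen I2 I2) * fgen (Tgen I1 I2)"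
    then show ?thesis by (simp add: simps bd flip: distrib_right)
  next
    assume "r = fgen (Tgen I2 I1) * fgen (Tgen I2 I2) + fgen (Tgen I2 I2) * fgen (Tgen I2 I1)"
    then show ?thesis by (simp add: simps cd flip: distrib_right)
  next
    assume "r = fgen (Tgen I2 I2) * fgen Dinv - 1"
    then show ?thesis by (cases v) (simp add: simps alg_simps)
  next
    assume "r = fgen Dinv * fgen (Tgen I2 I2) - 1"
    then show ?thesis by (cases v) (simp add: simps alg_simps)
  next
    assume "r = (fgen (Tgen I1 I1) * fgen (Tgen I2 I2) + fgen (Tgen I1 I2) * fgen (Tgen I2 I1)) *
      fgen Winv - 1"
    then show ?thesis
      by (cases v)
        (simp add: act_free_minus act_free_mult act_omega zero_prod_def,
          simp add: tri_def alg_simps right_diff_distrib)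
  next
    assume "r = fgen Winv *
      (fgen (Tgen I1 I1) * fgen (Tgen I2 I2) + fgen (Tgen I1 I2) * fgen (Tgen I2 I1)) - 1"
    then show ?thesis
      by (cases v)
        (simp add: act_free_minus act_free_mult act_omega zero_prod_def,
          simp add: tri_def alg_simps right_diff_distrib zero_prod_def)
  qed
qed

text \<open>The top row of the matrix is recovered by applying it to the unit columns.\<close>

definition \<kappa> :: "S14o_ext \<Rightarrow> S14o_ext" where
  "\<kappa> f = fst (act_alg f (1, 0))"

definition D :: "S14o_ext \<Rightarrow> S14o_ext" where
  "D f = fst (act_alg f (0, 1))"

lemma act_alg_pair: "act_alg f (x, y) = (\<kappa> f * x + D f * y, f * y)"
proof -
  \<comment> \<open>The operators multiply from the left, so they commute with right multiplication
    and are determined by their values on the unit columns.\<close>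
  have right: "act_alg f (x * z, y * z) = (fst (act_alg f (x, y)) * z, snd (act_alg f (x, y)) * z)"
    for x y z
  proof (induction f rule: alg_induct)
    case (monom w)
    show ?case unfolding act_alg_monom by (induction w) (simp_all add: tri_def alg_simps)
  qed (simp_all add: act_alg_plus act_alg_scale_left alg_simps)
  have snd: "snd (act_alg f v) = f * snd v" for v
  proof (induction f rule: alg_induct)
    case (monom w)
    show ?case unfolding act_alg_monom
    proof (induction w)
      case (Cons g w)
      then show ?case by (simp add: monom_Cons[of g w] tri_def alg_simps)
    qed (simp add: monom_Nil)
  qed (simp_all add: act_alg_plus act_alg_scale_left alg_simps)
  have "act_alg f (x, y) = act_alg f (1 * x, 0 * x) + act_alg f (0 * y, 1 * y)"
    by (simp flip: act_alg_add)
  then show ?thesis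
    unfolding right by (simp add: snd \<kappa>_def D_def)
qed

lemma D_mult: "D (f * g) = D f * g + \<kappa> f * D g"
  using act_alg_mult[of f g "(0, 1)"] by (simp add: act_alg_pair)

lemma \<kappa>_mult: "\<kappa> (f * g) = \<kappa> f * \<kappa> g"
  using act_alg_mult[of f g "(1, 0)"] by (simp add: act_alg_pair)

lemma \<kappa>_one [simp]: "\<kappa> 1 = 1"
  by (simp add: \<kappa>_def)

lemma linear_D: "Vector_Spaces.linear alg_scale alg_scale D"
  and linear_\<kappa>: "Vector_Spaces.linear alg_scale alg_scale \<kappa>"
  by unfold_locales
    (simp_all add: D_def \<kappa>_def act_alg_plus act_alg_scale_left)

lemma D_gen: "D (monom [Tgen i j]) = \<delta> i j"
  and \<kappa>_gen: "\<kappa> (monom [Tgen i j]) = s *\<^sub>C monom [Tgen i j]"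
  by (simp_all add: D_def \<kappa>_def tri_def)

end

lemma scale_minus_2: "(-2) *\<^sub>C x = - x - x"
proof -
  have "(-2) *\<^sub>C x = (-1 - 1) *\<^sub>C x" by simp
  then show ?thesis unfolding alg_vs.scale_left_diff_distrib by simp
qed

text \<open>In the four instances the sign \<open>s\<close> is 1 for the derivations A, B and -1 for
  the twisted X+, X-. The weight \<open>t\<close> of \<omega> is -2 for A, as \<omega> is quadratic
  in generators of weight -1, and 0 otherwise.\<close>

global_interpretation dA: skew_data 1 "-2" "\<lambda>i j. - monom [Tgen i j]"
  by unfold_locales (simp_all only: scale_minus_2, simp_all add: S14o_relations omega_def)

global_interpretation dB: skew_data 1 0
  "\<lambda>i j. if i = I1 then - monom [Tgen i j] else monom [Tgen i j]"
  by unfold_locales (simp_all add: S14o_relations)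

global_interpretation dXp: skew_data "-1" 0
  "\<lambda>i j. if i = I1 then monom [Tgen I2 j] else 0"
  by unfold_locales (simp_all add: S14o_relations)

global_interpretation dXm: skew_data "-1" 0
  "\<lambda>i j. if i = I2 then monom [Tgen I1 j] else 0"
  by unfold_locales (simp_all add: S14o_relations)

section \<open>Maps determined by their values on the matrix generators\<close>

abbreviation lin :: "(S14o_ext \<Rightarrow> S14o_ext) \<Rightarrow> bool" where
  "lin \<equiv> Vector_Spaces.linear alg_scale alg_scale"

lemma linI: "(\<And>x y. F (x + y) = F x + F y) \<Longrightarrow> (\<And>c x. F (c *\<^sub>C x) = c *\<^sub>C F x) \<Longrightarrow> lin F"
  by unfold_locales

lemma lin_add: "lin F \<Longrightarrow> F (x + y) = F x + F y"
  and lin_scale: "lin F \<Longrightarrow> F (c *\<^sub>C x) = c *\<^sub>C F x"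
  by (simp_all add: Vector_Spaces.linear_iff)

lemma lin_diff: "lin F \<Longrightarrow> F (x - y) = F x - F y"
  using lin_add[of F "x - y" y] by simp

lemma lin_minus: "lin F \<Longrightarrow> F (- x) = - F x"
  using lin_scale[of F "-1" x] by simp

lemma lin_zero: "lin F \<Longrightarrow> F 0 = 0"
  using lin_scale[of F 0 0] by simp

text \<open>The product rule carries zero from generators to words. For inverse elements
  \<open>x\<close>, \<open>y\<close> with \<open>E x = 0\<close> it gives
  \<open>\<tau> x * E y = 0\<close>, where multiplication by \<open>\<tau> y\<close> cancels
  \<open>\<tau> x\<close>.\<close>

lemma skew_vanish:
  assumes E: "Vector_Spaces.linear alg_scale alg_scale E"
    and mult: "\<And>f g. E (f * g) = E f * \<sigma> g + \<tau> f * E g"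
    and \<sigma>: "\<sigma> 1 = 1" and \<tau>: "\<tau> 1 = 1" "\<And>f g. \<tau> (f * g) = \<tau> f * \<tau> g"
    and gen: "\<And>i j. E (monom [Tgen i j]) = 0"
  shows "E f = 0"
proof -
  interpret E: Vector_Spaces.linear alg_scale alg_scale E by (rule E)
  have one: "E 1 = 0" using mult[of 1 1] \<sigma> \<tau> by simp
  have inv: "E y = 0" if "E x = 0" "x * y = 1" "y * x = 1" for x y
  proof -
    have "\<tau> x * E y = 0" using mult[of x y] one that by simp
    then have "\<tau> (y * x) * E y = 0" by (simp add: \<tau> mult.assoc)
    then show ?thesis using that \<tau> by simp
  qed
  have "E omega = 0" by (simp add: omega_def E.add mult gen)
  then have "E (monom [g]) = 0" for g
    using inv[of omega omega_inv] inv[of dhat dhat_inv] gen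
    by (cases g) (simp_all add: S14o_relations)
  then have "E (monom w) = 0" for w
  proof (induction w)
    case (Cons g w)
    then show ?case by (simp add: monom_Cons[of g w] mult)
  qed (simp add: monom_Nil one)
  then show ?thesis
    by (induction f rule: alg_induct) (simp_all add: E.add E.scale)
qed


text \<open>The difference of two homomorphisms is a skew derivation: it maps \<open>f * g\<close>
  to \<open>(\<sigma> f - \<tau> f) * \<sigma> g + \<tau> f * (\<sigma> g - \<tau>
  g)\<close>.\<close>

lemma hom_eq:
  assumes "lin \<sigma>" "lin \<tau>" and "\<sigma> 1 = 1" "\<tau> 1 = 1"
    and "\<And>f g. \<sigma> (f * g) = \<sigma> f * \<sigma> g" "\<And>f g. \<tau> (f * g) = \<tau> f * \<tau> g"
    and "\<And>i j. \<sigma> (monom [Tgen i j]) = \<tau> (monom [Tgen i j])"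
  shows "\<sigma> f = \<tau> f"
proof -
  have "\<sigma> f - \<tau> f = 0"
    by (rule skew_vanish[where E = "\<lambda>f. \<sigma> f - \<tau> f" and \<sigma> = \<sigma> and \<tau> = \<tau>])
      (auto intro!: linI simp: assms lin_add lin_scale algebra_simps alg_vs.scale_right_diff_distrib)
  then show ?thesis by simp
qed

text \<open>The sign automorphism by which K acts; it is the common twist of X+ and X-, here read
  off from the data of X+.\<close>

definition kap :: "S14o_ext \<Rightarrow> S14o_ext" where "kap = dXp.\<kappa>"

lemma lin_kap: "lin kap"
  and kap_mult: "kap (f * g) = kap f * kap g"
  and kap_one: "kap 1 = 1"
  and kap_gen: "kap (monom [Tgen i j]) = - monom [Tgen i j]"
  by (simp_all add: kap_def dXp.linear_\<kappa> dXp.\<kappa>_mult dXp.\<kappa>_gen)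

lemma lin_id: "lin (\<lambda>f. f)"
  by (rule linI) simp_all

lemma dA_\<kappa>: "dA.\<kappa> f = f" and dB_\<kappa>: "dB.\<kappa> f = f" and dXm_\<kappa>: "dXm.\<kappa> f = kap f"
  by (rule hom_eq; simp add: dA.linear_\<kappa> dB.linear_\<kappa> dXm.linear_\<kappa> lin_id lin_kap kap_one kap_mult kap_gen
      dA.\<kappa>_mult dB.\<kappa>_mult dXm.\<kappa>_mult dA.\<kappa>_gen dB.\<kappa>_gen dXm.\<kappa>_gen)+

lemma kap_kap [simp]: "kap (kap f) = f"
proof (rule hom_eq)
  show "lin (\<lambda>f. kap (kap f))"
    by (rule linI) (simp_all add: lin_add lin_scale lin_kap)
qed (simp_all add: lin_id lin_kap kap_one kap_mult kap_gen lin_minus)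

section \<open>The generators of s14o as operators and their relations\<close>

fun hopf_op :: "hopf_gen \<Rightarrow> S14o_ext \<Rightarrow> S14o_ext" where
  "hopf_op gA f = dA.D f"
| "hopf_op gB f = dB.D f"
| "hopf_op gXp f = dXp.D f"
| "hopf_op gXm f = dXm.D f"
| "hopf_op gK f = kap f"

lemma lin_hopf_op: "lin (hopf_op g)"
proof -
  have "hopf_op gA = dA.D" "hopf_op gB = dB.D" "hopf_op gXp = dXp.D" "hopf_op gXm = dXm.D"
    "hopf_op gK = kap"
    by (auto intro: ext)
  then show ?thesis
    by (cases g) (simp_all only: dA.linear_D dB.linear_D dXp.linear_D dXm.linear_D lin_kap)
qed

lemmas hopf_op_linear = lin_add[OF lin_hopf_op] lin_scale[OF lin_hopf_op]
  lin_diff[OF lin_hopf_op] lin_minus[OF lin_hopf_op] lin_zero[OF lin_hopf_op]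

lemma hopf_op_mult:
  "hopf_op gA (f * g) = hopf_op gA f * g + f * hopf_op gA g"
  "hopf_op gB (f * g) = hopf_op gB f * g + f * hopf_op gB g"
  "hopf_op gXp (f * g) = hopf_op gXp f * g + hopf_op gK f * hopf_op gXp g"
  "hopf_op gXm (f * g) = hopf_op gXm f * g + hopf_op gK f * hopf_op gXm g"
  "hopf_op gK (f * g) = hopf_op gK f * hopf_op gK g"
  by (simp_all add: dA.D_mult dB.D_mult dXp.D_mult dXm.D_mult dA_\<kappa> dB_\<kappa> dXm_\<kappa> kap_mult
      kap_def[symmetric])

lemma hopf_op_gen:
  "hopf_op gA (monom [Tgen i j]) = - monom [Tgen i j]"
  "hopf_op gB (monom [Tgen i j]) = (if i = I1 then - monom [Tgen i j] else monom [Tgen i j])"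
  "hopf_op gXp (monom [Tgen i j]) = (if i = I1 then monom [Tgen I2 j] else 0)"
  "hopf_op gXm (monom [Tgen i j]) = (if i = I2 then monom [Tgen I1 j] else 0)"
  "hopf_op gK (monom [Tgen i j]) = - monom [Tgen i j]"
  by (simp_all add: dA.D_gen dB.D_gen dXp.D_gen dXm.D_gen kap_gen)

lemma hopf_op_KK: "hopf_op gK (hopf_op gK f) = f" "hopf_op gK 1 = 1"
  by (simp_all add: kap_one)

declare hopf_op.simps [simp del]

text \<open>The commutator of two skew derivations is again one, so its vanishing can be tested on
  the matrix generators. Its twists depend on the two operators and are therefore
  parameters.\<close>

lemma hopf_op_commute:
  assumes "\<And>f g. hopf_op y (hopf_op x (f * g)) - hopf_op x (hopf_op y (f * g)) =
      (hopf_op y (hopf_op x f) - hopf_op x (hopf_op y f)) * \<sigma> g +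
      \<tau> f * (hopf_op y (hopf_op x g) - hopf_op x (hopf_op y g))"
    and "\<sigma> 1 = 1" and "\<tau> 1 = 1" "\<And>f g. \<tau> (f * g) = \<tau> f * \<tau> g"
    and "\<And>i j. hopf_op y (hopf_op x (monom [Tgen i j])) = hopf_op x (hopf_op y (monom [Tgen i j]))"
  shows "hopf_op y (hopf_op x f) = hopf_op x (hopf_op y f)"
proof -
  have "hopf_op y (hopf_op x f) - hopf_op x (hopf_op y f) = 0"
  proof (rule skew_vanish[where E = "\<lambda>f. hopf_op y (hopf_op x f) - hopf_op x (hopf_op y f)"
        and \<sigma> = \<sigma> and \<tau> = \<tau>])
    show "lin (\<lambda>f. hopf_op y (hopf_op x f) - hopf_op x (hopf_op y f))"
      by (intro linI) (simp_all add: hopf_op_linear alg_vs.scale_right_diff_distrib)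
  qed (rule assms(1-4) | simp add: assms(5))+
  then show ?thesis by simp
qed

lemma hopf_op_KA: "hopf_op gA (hopf_op gK f) = hopf_op gK (hopf_op gA f)"
  by (rule hopf_op_commute[where \<sigma> = "hopf_op gK" and \<tau> = "hopf_op gK"])
    (simp_all add: hopf_op_mult hopf_op_linear hopf_op_gen hopf_op_KK algebra_simps)

lemma hopf_op_KB: "hopf_op gB (hopf_op gK f) = hopf_op gK (hopf_op gB f)"
  by (rule hopf_op_commute[where \<sigma> = "hopf_op gK" and \<tau> = "hopf_op gK"])
    (simp_all add: hopf_op_mult hopf_op_linear hopf_op_gen hopf_op_KK algebra_simps)

lemma hopf_op_KXp: "hopf_op gXp (hopf_op gK f) = hopf_op gK (hopf_op gXp f)"
  \<comment> \<open>The left twist of this commutator is K applied twice, hence the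
    identity.\<close>
  by (rule hopf_op_commute[where \<sigma> = "hopf_op gK" and \<tau> = "\<lambda>f. f"])
    (simp_all add: hopf_op_mult hopf_op_linear hopf_op_gen hopf_op_KK algebra_simps)

lemma hopf_op_KXm: "hopf_op gXm (hopf_op gK f) = hopf_op gK (hopf_op gXm f)"
  by (rule hopf_op_commute[where \<sigma> = "hopf_op gK" and \<tau> = "\<lambda>f. f"])
    (simp_all add: hopf_op_mult hopf_op_linear hopf_op_gen hopf_op_KK algebra_simps)

lemma hopf_op_AB: "hopf_op gA (hopf_op gB f) = hopf_op gB (hopf_op gA f)"
  by (rule hopf_op_commute[where \<sigma> = "\<lambda>f. f" and \<tau> = "\<lambda>f. f"])
    (simp_all add: hopf_op_mult hopf_op_linear hopf_op_gen algebra_simps)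

lemma hopf_op_AXp: "hopf_op gA (hopf_op gXp f) = hopf_op gXp (hopf_op gA f)"
  by (rule hopf_op_commute[where \<sigma> = "\<lambda>f. f" and \<tau> = "hopf_op gK"])
    (simp_all add: hopf_op_mult hopf_op_linear hopf_op_gen hopf_op_KA hopf_op_KK algebra_simps)

lemma hopf_op_AXm: "hopf_op gA (hopf_op gXm f) = hopf_op gXm (hopf_op gA f)"
  by (rule hopf_op_commute[where \<sigma> = "\<lambda>f. f" and \<tau> = "hopf_op gK"])
    (simp_all add: hopf_op_mult hopf_op_linear hopf_op_gen hopf_op_KA hopf_op_KK algebra_simps)

lemma scale_2: "2 *\<^sub>C x = x + x"
  using alg_vs.scale_left_distrib[of 1 1 x] by simp

text \<open>The commutator and twice X+ are skew with the same twist K, since B commutes with K; so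
  it suffices to compare them on generators.\<close>

lemma hopf_op_BXp:
  "hopf_op gB (hopf_op gXp f) - hopf_op gXp (hopf_op gB f) = 2 *\<^sub>C hopf_op gXp f"
proof -
  have "hopf_op gB (hopf_op gXp f) - hopf_op gXp (hopf_op gB f) - 2 *\<^sub>C hopf_op gXp f = 0"
    by (rule skew_vanish[where
          E = "\<lambda>f. hopf_op gB (hopf_op gXp f) -
            hopf_op gXp (hopf_op gB f) - 2 *\<^sub>C hopf_op gXp f"
          and \<sigma> = "\<lambda>f. f" and \<tau> = "hopf_op gK"])
     (auto intro!: linI simp: hopf_op_mult hopf_op_linear hopf_op_gen hopf_op_KB hopf_op_KK
        algebra_simps scale_2)
  then show ?thesis by simp
qed

lemma hopf_op_BXm:
  "hopf_op gB (hopf_op gXm f) - hopf_op gXm (hopf_op gB f) = - (2 *\<^sub>C hopf_op gXm f)"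
proof -
  have "hopf_op gB (hopf_op gXm f) - hopf_op gXm (hopf_op gB f) + 2 *\<^sub>C hopf_op gXm f = 0"
    by (rule skew_vanish[where
          E = "\<lambda>f. hopf_op gB (hopf_op gXm f) -
            hopf_op gXm (hopf_op gB f) + 2 *\<^sub>C hopf_op gXm f"
          and \<sigma> = "\<lambda>f. f" and \<tau> = "hopf_op gK"])
     (auto intro!: linI simp: hopf_op_mult hopf_op_linear hopf_op_gen hopf_op_KB hopf_op_KK
        algebra_simps scale_2 alg_vs.scale_right_diff_distrib)
  then show ?thesis by (simp add: eq_neg_iff_add_eq_0)
qed

lemma idx_neq: "i \<noteq> I1 \<longleftrightarrow> i = I2"
  by (cases i) simp_all

text \<open>This commutator is an ordinary derivation like B: K applied twice is the identity, and
  the mixed terms cancel because K commutes with X+ and X-.\<close>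

lemma hopf_op_XpXm:
  "hopf_op gXp (hopf_op gXm f) - hopf_op gXm (hopf_op gXp f) = hopf_op gB f"
proof -
  have "hopf_op gXp (hopf_op gXm f) - hopf_op gXm (hopf_op gXp f) - hopf_op gB f = 0"
    by (rule skew_vanish[where
          E = "\<lambda>f. hopf_op gXp (hopf_op gXm f) -
            hopf_op gXm (hopf_op gXp f) - hopf_op gB f"
          and \<sigma> = "\<lambda>f. f" and \<tau> = "\<lambda>f. f"])
     (auto intro!: linI simp: hopf_op_mult hopf_op_linear hopf_op_gen hopf_op_KXp hopf_op_KXm
        hopf_op_KK algebra_simps idx_neq)
  then show ?thesis by simp
qed

global_interpretation hopf: generator_ops alg_scale hopf_op
  by unfold_locales (simp_all add: hopf_op_linear)

global_interpretation hopf: presented_ops alg_scale hopf_op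
proof
  fix r :: "hopf_gen free" and f
  assume r: "r \<in> relators"
  have A: "hopf_op gA (hopf_op g f) = hopf_op g (hopf_op gA f)" for g
    by (cases g) (simp_all add: hopf_op_KA hopf_op_AB hopf_op_AXp hopf_op_AXm)
  have K: "hopf_op gK (hopf_op g f) = hopf_op g (hopf_op gK f)" for g
    by (cases g) (simp_all add: hopf_op_KA hopf_op_KB hopf_op_KXp hopf_op_KXm)
  note simps = hopf.act_free_plus hopf.act_free_minus hopf.act_free_mult
  consider g where "r = fgen gA * fgen g - fgen g * fgen gA"
    | g where "r = fgen gK * fgen g - fgen g * fgen gK"
    | "r = fgen gK * fgen gK - 1"
    | "r = fgen gB * fgen gXp - fgen gXp * fgen gB - fscalar 2 * fgen gXp"
    | "r = fgen gB * fgen gXm - fgen gXm * fgen gB + fscalar 2 * fgen gXm"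
    | "r = fgen gXp * fgen gXm - fgen gXm * fgen gXp - fgen gB"
    using r unfolding relators_hopf_gen_def Let_def by blast
  then show "hopf.act_free r f = 0"
  proof cases
    case (1 g)
    then show ?thesis using A[of g] by (simp add: simps)
  next
    case (2 g)
    then show ?thesis using K[of g] by (simp add: simps)
  qed (simp_all add: simps hopf_op_KK hopf_op_BXp hopf_op_BXm hopf_op_XpXm)
qed

section \<open>The left action\<close>

text \<open>Sweedler notation for the matrix coproduct.\<close>

definition msum :: "mat_word \<Rightarrow> (mat_word \<Rightarrow> mat_word \<Rightarrow> 'a::comm_monoid_add) \<Rightarrow> 'a" where
  "msum w h = (\<Sum>(f, g)\<leftarrow>mat_cop w. h f g)"

lemma msum_Nil [simp]: "msum [] h = h [] []"
  by (simp add: msum_def)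

lemma msum_Cons [simp]:
  "msum ((i, j) # w) h = msum w (\<lambda>f g. h ((i, I1) # f) ((I1, j) # g)) +
    msum w (\<lambda>f g. h ((i, I2) # f) ((I2, j) # g))"
  by (simp add: msum_def split_def comp_def)

lemma msum_add: "msum w (\<lambda>f g. h f g + k f g) = msum w h + msum w k"
  by (simp add: msum_def split_def sum_list_addf)

lemma msum_hom:
  assumes "L 0 = 0" "\<And>x y. L (x + y) = L x + L y"
  shows "L (msum w h) = msum w (\<lambda>f g. L (h f g))"
proof -
  have "L (sum_list (map (\<lambda>(f, g). h f g) xs)) = sum_list (map (\<lambda>(f, g). L (h f g)) xs)" for xs
    by (induction xs) (auto simp: assms)
  then show ?thesis by (simp add: msum_def)
qed

text \<open>On both sides each letter contributes the same sum over two intermediate indices, only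
  in a different order.\<close>

lemma msum_coassoc:
  "msum w (\<lambda>f g. msum f (\<lambda>f1 f2. h f1 f2 g)) = msum w (\<lambda>f g. msum g (\<lambda>g1 g2. h f g1 g2))"
proof (induction w arbitrary: h)
  case (Cons t w)
  then show ?case by (cases t) (simp add: msum_add add_ac)
qed simp

lemma mat_counit_simps [simp]:
  "mat_counit [] = 1" "mat_counit ((i, j) # w) = (if i = j then mat_counit w else 0)"
  by (simp_all add: mat_counit_def)

lemma msum_zero [simp]: "msum w (\<lambda>f g. 0) = 0"
  by (simp add: msum_def split_def)

lemma msum_counit_right: "msum w (\<lambda>f g. h f * mat_counit g) = (h w :: complex)"
proof (induction w arbitrary: h)
  case (Cons t w)
  show ?case
    using Cons[of "\<lambda>f. h ((fst t, I1) # f)"] Cons[of "\<lambda>f. h ((fst t, I2) # f)"]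
    by (cases t; cases "snd t") simp_all
qed simp

lemma msum_counit_left: "msum w (\<lambda>f g. mat_counit f * h g) = (h w :: complex)"
proof (induction w arbitrary: h)
  case (Cons t w)
  show ?case
    using Cons[of "\<lambda>f. h ((I1, snd t) # f)"] Cons[of "\<lambda>f. h ((I2, snd t) # f)"]
    by (cases t; cases "fst t") simp_all
qed simp

lemma msum_counit_scale: "msum w (\<lambda>f g. mat_counit f *\<^sub>C h g) = h w"
proof (induction w arbitrary: h)
  case (Cons t w)
  show ?case
    using Cons[of "\<lambda>f. h ((I1, snd t) # f)"] Cons[of "\<lambda>f. h ((I2, snd t) # f)"]
    by (cases t; cases "fst t") simp_all
qed simp

text \<open>Merges the cases in the recursion of \<open>pair\<close>; for an empty tail it is the
  counit axiom.\<close>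

lemma pair_Cons: "pair (z # zs) w = msum w (\<lambda>f g. pair [z] f * pair zs g)"
  by (cases zs) (simp_all add: msum_counit_right, simp add: msum_def)

lemma pair_append: "pair (zs @ zs') w = msum w (\<lambda>f g. pair zs f * pair zs' g)"
proof (induction zs arbitrary: w)
  case (Cons z zs)
  have "pair ((z # zs) @ zs') w = msum w (\<lambda>f g. pair [z] f * msum g (\<lambda>g1 g2. pair zs g1 * pair zs' g2))"
    by (simp add: pair_Cons[of z "zs @ zs'"] Cons)
  also have "\<dots> = msum w (\<lambda>f g. msum g (\<lambda>g1 g2. pair [z] f * (pair zs g1 * pair zs' g2)))"
    by (subst msum_hom[of "(*) _"]) (simp_all add: algebra_simps)
  also have "\<dots> = msum w (\<lambda>f g. msum f (\<lambda>f1 f2. pair [z] f1 * pair zs f2) * pair zs' g)"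
    by (subst msum_hom[of "\<lambda>x. x * _"]) (simp_all add: msum_coassoc[symmetric] algebra_simps)
  finally show ?case by (simp add: pair_Cons[of z zs])
qed (simp add: msum_counit_left)

lemma pair_single_Cons:
  "pair [z] (t # w) = (\<Sum>(p, q)\<leftarrow>cop_gen z. pair p [t] * pair q w)"
  by (cases w; cases z; cases t) (auto simp: counit_def)

declare pair.simps(4,5) [simp del]

lemma pair_recursion:
  "pair [gA] (t # w) = pair_gen gA t * mat_counit w + mat_counit [t] * pair [gA] w"
  "pair [gB] (t # w) = pair_gen gB t * mat_counit w + mat_counit [t] * pair [gB] w"
  "pair [gXp] (t # w) = pair_gen gXp t * pair [gK] w + mat_counit [t] * pair [gXp] w"
  "pair [gXm] (t # w) = pair_gen gXm t * pair [gK] w + mat_counit [t] * pair [gXm] w"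
  "pair [gK] (t # w) = pair_gen gK t * pair [gK] w"
  by (subst pair_single_Cons; simp)+

lemma msum_mult_left: "msum w (\<lambda>f g. c * h f g) = (c::complex) * msum w h"
  by (subst msum_hom[of "(*) c"]) (simp_all add: algebra_simps)

lemma pair_KK: "pair [gK, gK] w = mat_counit w"
proof (induction w)
  case (Cons t w)
  then show ?case
    by (cases t; cases "fst t"; cases "snd t") (simp_all add: pair_Cons[of gK "[gK]"] pair_recursion)
qed (simp add: pair_Cons[of gK "[gK]"] counit_def)

lemma msum_minus: "msum w (\<lambda>f g. - h f g) = - msum w (h :: _ \<Rightarrow> _ \<Rightarrow> complex)"
  by (subst msum_hom[of uminus]) simp_all

text \<open>Evaluates the antipode of X+ and X-, which is \<open>- X K\<close>. In the first summand
  the two factors K recombine to their square, which pairs as the counit by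
  \<open>pair_KK\<close>.\<close>

lemma pair_XK:
  assumes "x = gXp \<or> x = gXm"
  shows "pair [x, gK] (t # w) = - pair_gen x t * mat_counit w - mat_counit [t] * pair [x, gK] w"
  using assms pair_KK[of w]
  by (cases t; cases "fst t"; cases "snd t")
    (auto simp: pair_Cons[of _ "[gK]"] pair_recursion msum_minus msum_add algebra_simps)

text \<open>The functional by which \<open>z\<close> acts on the first tensor factor: pairing with
  the antipode of \<open>z\<close>.\<close>

definition \<chi> :: "hopf_gen \<Rightarrow> mat_word \<Rightarrow> complex" where
  "\<chi> z w = fst (antipode_gen z) * pair (snd (antipode_gen z)) w"

lemma left_action_word_single: "left_action_word [z] w = msum w (\<lambda>f g. \<chi> z f *\<^sub>C mat_monom g)"
  by (simp add: left_action_word_def msum_def \<chi>_def split_def)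

lemma \<chi>_Nil: "\<chi> z [] = (if z = gK then 1 else 0)"
  by (cases z) (simp_all add: \<chi>_def pair_Cons[of _ "[gK]"] counit_def)

lemma \<chi>_Cons:
  "\<chi> gK (t # w) = - mat_counit [t] * \<chi> gK w"
  "z = gA \<or> z = gB \<Longrightarrow> \<chi> z (t # w) = - pair_gen z t * mat_counit w + mat_counit [t] * \<chi> z w"
  "z = gXp \<or> z = gXm \<Longrightarrow> \<chi> z (t # w) = pair_gen z t * mat_counit w - mat_counit [t] * \<chi> z w"
  by (cases t; auto simp: \<chi>_def pair_recursion pair_XK; fail)+


lemma hopf_op_one: "hopf_op z 1 = (if z = gK then 1 else 0)"
  using hopf_op_mult[of 1 1] by (cases z) (simp_all add: hopf_op_KK)

lemma msum_op: "msum w (\<lambda>f g. c f g *\<^sub>C hopf_op z (h f g)) = hopf_op z (msum w (\<lambda>f g. c f g *\<^sub>C h f g))"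
  by (subst msum_hom[of "hopf_op z"]) (simp_all add: hopf_op_linear)

lemma msum_scale_left: "msum w (\<lambda>f g. c *\<^sub>C h f g) = c *\<^sub>C msum w h"
  by (subst msum_hom[of "alg_scale c"]) (simp_all add: alg_vs.scale_right_distrib)

lemma msum_mult_alg: "msum w (\<lambda>f g. x * h f g) = x * msum w (h :: _ \<Rightarrow> _ \<Rightarrow> S14o_ext)"
  by (subst msum_hom[of "(*) x"]) (simp_all add: distrib_left)

text \<open>A common form for the three recursions in \<open>\<chi>_Cons\<close>. The counit term
  replaces the first letter and leaves the rest alone, the other term keeps the first letter and
  acts on the rest: together the product rule.\<close>

lemma left_action_word_single_Cons:
  assumes "\<And>k w. \<chi> z ((i, k) # w) =
    p k * mat_counit w + (if i = k then r * \<chi> z w else 0)"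
  shows "left_action_word [z] ((i, j) # w) =
    p I1 *\<^sub>C (monom [Tgen I1 j] * mat_monom w) + p I2 *\<^sub>C (monom [Tgen I2 j] * mat_monom w) +
    r *\<^sub>C (monom [Tgen i j] * left_action_word [z] w)"
proof -
  have "msum w (\<lambda>f g. \<chi> z ((i, k) # f) *\<^sub>C mat_monom ((k, j) # g)) =
      p k *\<^sub>C (monom [Tgen k j] * mat_monom w) +
      (if i = k then r *\<^sub>C (monom [Tgen i j] * left_action_word [z] w) else 0)" for k
  proof -
    have "msum w (\<lambda>f g. mat_counit f *\<^sub>C (p k *\<^sub>C mat_monom ((k, j) # g))) =
        p k *\<^sub>C (monom [Tgen k j] * mat_monom w)"
      by (subst msum_counit_scale) (simp add: monom_Cons[of "Tgen k j" "map _ _"])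
    moreover have "msum w (\<lambda>f g. (r * \<chi> z f) *\<^sub>C mat_monom ((k, j) # g)) =
        r *\<^sub>C (monom [Tgen k j] * left_action_word [z] w)"
      by (simp add: monom_Cons[of "Tgen k j" "map _ _"] left_action_word_single
          alg_scale_mult_right[symmetric] msum_scale_left msum_mult_alg flip: alg_vs.scale_scale)
    ultimately show ?thesis
      by (auto simp: assms alg_vs.scale_left_distrib msum_add mult.commute)
  qed
  note this[of I1] this[of I2]
  then show ?thesis
    by (cases i) (simp_all add: left_action_word_single add_ac)
qed

lemma left_action_word_single_eq: "left_action_word [z] w = hopf_op z (mat_monom w)"
proof (induction w)
  case Nil
  show ?case by (simp add: left_action_word_single \<chi>_Nil monom_Nil hopf_op_one)
next
  case (Cons t w)
  obtain i j where t: "t = (i, j)" by force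
  \<comment> \<open>\<open>r\<close> is the sign with which \<open>z\<close> passes a letter, -1
    where its coproduct involves K. \<open>p k\<close> is the coefficient of \<open>Tgen k j\<close>
    in the value at \<open>Tgen i j\<close>; it is 0 for K, which acts multiplicatively.\<close>
  define r :: complex where "r = (if z = gA \<or> z = gB then 1 else -1)"
  define p where "p k = (if z = gK then 0 else - r * pair_gen z (i, k))" for k
  have "\<chi> z ((i, k) # w) = p k * mat_counit w + (if i = k then r * \<chi> z w else 0)" for k w
    by (cases z) (auto simp: r_def p_def \<chi>_Cons)
  from left_action_word_single_Cons[OF this, of j w] Cons show ?case
    by (cases z; cases i)
      (simp_all add: t r_def p_def monom_Cons[of "Tgen i j" "map _ _"]
        monom_Cons[of "Tgen I1 j" "map _ _"] monom_Cons[of "Tgen I2 j" "map _ _"]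
        hopf_op_mult hopf_op_gen)
qed

lemma left_action_word_alt:
  "left_action_word zs w =
    msum w (\<lambda>f g. (fst (antipode zs) * pair (snd (antipode zs)) f) *\<^sub>C mat_monom g)"
  by (simp add: left_action_word_def msum_def split_def)

text \<open>The antipode reverses words, and so does pairing with the first tensor factor; the two
  reversals cancel, so a word acts as the composition of its letters.\<close>

lemma left_action_word_eq: "left_action_word zs w = hopf.act_word zs (mat_monom w)"
proof (induction zs)
  case Nil
  show ?case by (simp add: left_action_word_alt msum_counit_scale)
next
  case (Cons z zs)
  obtain c p d q where cp: "antipode_gen z = (c, p)" and dq: "antipode zs = (d, q)"
    by (cases "antipode_gen z"; cases "antipode zs") auto
  have "left_action_word (z # zs) w = msum w (\<lambda>f g. (c * d * pair (q @ p) f) *\<^sub>C mat_monom g)"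
    by (simp add: left_action_word_alt cp dq)
  also have "\<dots> = msum w (\<lambda>f g. msum f (\<lambda>f1 f2. (d * pair q f1) *\<^sub>C (c * pair p f2) *\<^sub>C mat_monom g))"
  proof -
    have "(c * d * pair (q @ p) f) *\<^sub>C x = msum f (\<lambda>f1 f2. (d * pair q f1) *\<^sub>C (c * pair p f2) *\<^sub>C x)"
      for f and x :: S14o_ext
    proof -
      have "msum f (\<lambda>f1 f2. (d * pair q f1) *\<^sub>C (c * pair p f2) *\<^sub>C x) =
          msum f (\<lambda>f1 f2. (c * d * (pair q f1 * pair p f2)) *\<^sub>C x)"
        by (simp add: ac_simps)
      also have "\<dots> = msum f (\<lambda>f1 f2. c * d * (pair q f1 * pair p f2)) *\<^sub>C x"
        by (rule msum_hom[of "\<lambda>a. a *\<^sub>C x", symmetric]) (simp_all add: alg_vs.scale_left_distrib)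
      finally show ?thesis by (simp add: msum_mult_left pair_append)
    qed
    then show ?thesis by simp
  qed
  \<comment> \<open>Coassociativity moves the factor belonging to \<open>z\<close> to the second
    tensor leg, where it forms the action of the single letter \<open>z\<close>.\<close>
  also have "\<dots> = msum w (\<lambda>f g. (d * pair q f) *\<^sub>C left_action_word [z] g)"
    by (simp add: msum_coassoc msum_scale_left left_action_word_alt cp del: alg_vs.scale_scale)
  also have "\<dots> = hopf_op z (left_action_word zs w)"
    by (simp add: left_action_word_single_eq msum_op left_action_word_alt[of zs] dq)
  finally show ?case by (simp add: Cons)
qed

section \<open>The product rule for words, and existence of the action\<close>

definition csum :: "hopf_gen list \<Rightarrow> (hopf_gen list \<Rightarrow> hopf_gen list \<Rightarrow> 'a::comm_monoid_add) \<Rightarrow> 'a" where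
  "csum zs F = (\<Sum>(p, q)\<leftarrow>cop zs. F p q)"

lemma csum_Nil [simp]: "csum [] F = F [] []"
  by (simp add: csum_def)

lemma csum_Cons:
  "csum (gA # zs) F = csum zs (\<lambda>p q. F (gA # p) q) + csum zs (\<lambda>p q. F p (gA # q))"
  "csum (gB # zs) F = csum zs (\<lambda>p q. F (gB # p) q) + csum zs (\<lambda>p q. F p (gB # q))"
  "csum (gXp # zs) F = csum zs (\<lambda>p q. F (gXp # p) (gK # q)) + csum zs (\<lambda>p q. F p (gXp # q))"
  "csum (gXm # zs) F = csum zs (\<lambda>p q. F (gXm # p) (gK # q)) + csum zs (\<lambda>p q. F p (gXm # q))"
  "csum (gK # zs) F = csum zs (\<lambda>p q. F (gK # p) (gK # q))"
  by (simp_all add: csum_def split_def comp_def)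

lemma csum_op: "hopf_op z (csum zs F) = csum zs (\<lambda>p q. hopf_op z (F p q))"
proof -
  have "hopf_op z (sum_list (map (\<lambda>(p, q). F p q) xs)) =
      sum_list (map (\<lambda>(p, q). hopf_op z (F p q)) xs)" for xs
    by (induction xs) (auto simp: hopf_op_linear)
  then show ?thesis by (simp add: csum_def)
qed

lemma csum_add: "csum zs (\<lambda>p q. F p q + G p q) = csum zs F + csum zs G"
  by (simp add: csum_def split_def sum_list_addf)

lemma act_word_mult:
  "hopf.act_word zs (x * y) = csum zs (\<lambda>p q. hopf.act_word q x * hopf.act_word p y)"
proof (induction zs)
  case (Cons z zs)
  then show ?case
    by (cases z) (simp_all add: csum_Cons csum_op hopf_op_mult csum_add add_ac)
qed simp

lemma act_word_one: "hopf.act_word zs 1 = counit zs *\<^sub>C 1"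
  by (induction zs) (simp_all add: counit_def hopf_op_linear hopf_op_one)

lemma is_left_action_hopf: "is_left_action hopf.act_alg"
  unfolding is_left_action_def
  by (auto intro!: linI Vector_Spaces.linear_iff[THEN iffD2] simp: left_action_word_eq act_word_one
      act_word_mult csum_def hopf.act_alg_add hopf.act_alg_scale hopf.act_alg_plus
      hopf.act_alg_scale_left alg_vs.vector_space_axioms)

text \<open>Induction measure for uniqueness on the inverses: the letters that some summand of the
  coproduct removes from the first tensor factor.\<close>

abbreviation noncentral_count :: "hopf_gen list \<Rightarrow> nat" where
  "noncentral_count zs \<equiv> length (filter (\<lambda>z. z \<noteq> gK) zs)"

text \<open>Taking the first summand for every letter keeps the whole word on the left and puts only
  letters K on the right; every other choice loses a letter different from K on the left.\<close>

lemma cop_leading_term: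
  obtains m R where "cop zs = (zs, replicate m gK) # R"
    and "\<And>p q. (p, q) \<in> set R \<Longrightarrow> noncentral_count p < noncentral_count zs"
proof -
  have "\<exists>m R. cop zs = (zs, replicate m gK) # R \<and>
      (\<forall>(p, q)\<in>set R. noncentral_count p < noncentral_count zs)"
  proof (induction zs)
    case (Cons z zs)
    then obtain m R where 1: "cop zs = (zs, replicate m gK) # R"
      and 2: "\<forall>(p, q)\<in>set R. noncentral_count p < noncentral_count zs" by blast
    from 2 show ?case
      by (cases z) (fastforce simp: 1 simp flip: replicate_Suc)+
  qed simp
  then show ?thesis using that by blast
qed


lemma left_action_unique_inverse:
  assumes \<pi>: "is_left_action \<pi>" and x: "\<And>zs. \<pi> (monom zs) x = hopf.act_word zs x"
    and inv: "y * x = 1" "x * y = 1" and K: "hopf_op gK x = x \<or> hopf_op gK x = - x"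
  shows "\<pi> (monom zs) y = hopf.act_word zs y"
proof (induction zs rule: measure_induct_rule[of noncentral_count])
  case (less zs)
  obtain m R where R: "cop zs = (zs, replicate m gK) # R"
    and less_R: "\<And>p q. (p, q) \<in> set R \<Longrightarrow> noncentral_count p < noncentral_count zs"
    using cop_leading_term by blast
  have "\<pi> (monom zs) (x * y) = hopf.act_word zs (x * y)"
    using \<pi> by (simp add: inv act_word_one is_left_action_def)
  then have "(\<Sum>(p, q)\<leftarrow>cop zs. hopf.act_word q x * \<pi> (monom p) y) =
      (\<Sum>(p, q)\<leftarrow>cop zs. hopf.act_word q x * hopf.act_word p y)"
    using \<pi> by (simp add: x act_word_mult csum_def is_left_action_def)
  \<comment> \<open>By the induction hypothesis all summands but the leading one agree.\<close>
  moreover have "map (\<lambda>(p, q). hopf.act_word q x * \<pi> (monom p) y) R =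
      map (\<lambda>(p, q). hopf.act_word q x * hopf.act_word p y) R"
    using less less_R by auto
  ultimately have eq: "hopf.act_word (replicate m gK) x * \<pi> (monom zs) y =
      hopf.act_word (replicate m gK) x * hopf.act_word zs y"
    by (simp add: R)
  \<comment> \<open>K changes \<open>x\<close> at most by a sign, so the factor in front of the
    leading term can be cancelled with \<open>y\<close>.\<close>
  have "hopf.act_word (replicate m gK) x = x \<or> hopf.act_word (replicate m gK) x = - x"
    using K by (induction m) (auto simp: hopf_op_linear)
  with eq have "x * \<pi> (monom zs) y = x * hopf.act_word zs y" by auto
  then have "y * x * \<pi> (monom zs) y = y * x * hopf.act_word zs y" by (simp add: mult.assoc)
  then show ?case by (simp add: inv)
qed

lemma K_omega: "hopf_op gK omega = omega"
  by (simp add: omega_def hopf_op_mult hopf_op_linear hopf_op_gen)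

text \<open>The values are forced in turn: on the matrix generators by the pairing, on \<omega> by
  the product rule, on the two inverses by the preceding argument, on words again by the product
  rule, then by linearity in both arguments.\<close>

lemma left_action_unique:
  assumes \<pi>: "is_left_action \<pi>"
  shows "\<pi> = hopf.act_alg"
proof -
  have linear: "lin (\<pi> Z)" "Vector_Spaces.linear alg_scale alg_scale (\<lambda>Z. \<pi> Z x)" for Z x
    using \<pi> by (simp_all add: is_left_action_def)
  have mult: "\<pi> (monom zs) (x * y) = (\<Sum>(p, q)\<leftarrow>cop zs. \<pi> (monom q) x * \<pi> (monom p) y)" for zs x y
    using \<pi> by (simp add: is_left_action_def)
  have T: "\<pi> (monom zs) (monom [Tgen i j]) = hopf.act_word zs (monom [Tgen i j])" for zs i j
  proof -
    have "\<pi> (monom zs) (mat_monom [(i, j)]) = left_action_word zs [(i, j)]"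
      using \<pi> unfolding is_left_action_def by blast
    then show ?thesis by (simp add: left_action_word_eq)
  qed
  have prod: "\<pi> (monom zs) (x * y) = hopf.act_word zs (x * y)"
    if "\<And>zs. \<pi> (monom zs) x = hopf.act_word zs x" "\<And>zs. \<pi> (monom zs) y = hopf.act_word zs y" for zs x y
    by (simp add: mult act_word_mult csum_def that)
  have omega: "\<pi> (monom zs) omega = hopf.act_word zs omega" for zs
    using linear(1) by (simp add: omega_def lin_add prod T hopf.act_word_add)
  have omega_inv: "\<pi> (monom zs) omega_inv = hopf.act_word zs omega_inv" for zs
    by (rule left_action_unique_inverse[OF \<pi>, of omega])
      (simp_all add: S14o_relations omega K_omega)
  have dhat_inv: "\<pi> (monom zs) dhat_inv = hopf.act_word zs dhat_inv" for zs
    by (rule left_action_unique_inverse[OF \<pi>, of dhat]) (simp_all add: T S14o_relations hopf_op_gen)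
  have gen: "\<pi> (monom zs) (monom [g]) = hopf.act_word zs (monom [g])" for zs g
    by (cases g) (simp_all add: T omega_inv dhat_inv)
  have word: "\<pi> (monom zs) (monom w) = hopf.act_word zs (monom w)" for zs w
  proof (induction w arbitrary: zs)
    case Nil
    then show ?case using \<pi> by (simp add: monom_Nil act_word_one is_left_action_def)
  next
    case (Cons g w)
    then show ?case by (simp add: monom_Cons[of g w] prod gen)
  qed
  have alg: "\<pi> (monom zs) x = hopf.act_word zs x" for zs x
    by (induction x rule: alg_induct)
      (simp_all add: word linear(1) lin_add lin_scale hopf.act_word_add hopf.act_word_scale)
  have "\<pi> Z x = hopf.act_alg Z x" for Z x
    using linear(2)[of x]
    by (induction Z rule: alg_induct)
      (simp_all add: alg hopf.act_alg_plus hopf.act_alg_scale_left Vector_Spaces.linear_iff)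
  then show ?thesis by blast
qed

lemma ex1_left_action: "\<exists>!\<pi>. is_left_action \<pi>"
  using is_left_action_hopf left_action_unique by blast

lemma piL_eq: "piL = hopf.act_alg"
proof -
  have "is_left_action piL" unfolding piL_def by (rule theI'[OF ex1_left_action])
  then show ?thesis by (rule left_action_unique)
qed

section \<open>The action on the vectors u and v\<close>

lemma int_pow_0 [simp]: "int_pow x y 0 = 1"
  by (simp add: int_pow_def)

lemma int_pow_Suc:
  assumes "x * y = 1" "y * x = 1"
  shows "x * int_pow x y n = int_pow x y (n + 1)" "y * int_pow x y n = int_pow x y (n - 1)"
proof -
  have cancel: "x * (y * z) = z" "y * (x * z) = z" for z
    using assms by (simp_all flip: mult.assoc)
  show "x * int_pow x y n = int_pow x y (n + 1)"
  proof (cases "n \<ge> 0")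
    case True
    then have "nat (n + 1) = Suc (nat n)" by simp
    with True show ?thesis by (simp add: int_pow_def)
  next
    case False
    then have "nat (- n) = Suc (nat (- (n + 1)))" by simp
    with False show ?thesis by (auto simp: int_pow_def cancel)
  qed
  show "y * int_pow x y n = int_pow x y (n - 1)"
  \<comment> \<open>The border is at 1, since for \<open>n = 0\<close> the exponent
    \<open>n - 1\<close> already counts powers of the inverse.\<close>
  proof (cases "n \<ge> 1")
    case True
    then have "nat n = Suc (nat (n - 1))" by simp
    with True show ?thesis by (simp add: int_pow_def cancel)
  next
    case False
    then have "nat (- (n - 1)) = Suc (nat (- n))" by simp
    with False show ?thesis by (auto simp: int_pow_def)
  qed
qed

lemmas dpow_Suc = int_pow_Suc[OF S14o_relations(7,8)]

section \<open>Weights, signs and annihilation for the factors of u\<close>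

lemma derivation_eigen_mult:
  assumes "z = gA \<or> z = gB" "hopf_op z x = \<alpha> *\<^sub>C x" "hopf_op z y = \<beta> *\<^sub>C y"
  shows "hopf_op z (x * y) = (\<alpha> + \<beta>) *\<^sub>C (x * y)"
  using assms by (auto simp: hopf_op_mult alg_scale_mult_left alg_scale_mult_right
      alg_vs.scale_left_distrib)

lemma derivation_eigen_power:
  assumes "z = gA \<or> z = gB" "hopf_op z x = \<alpha> *\<^sub>C x"
  shows "hopf_op z (x ^ n) = (of_nat n * \<alpha>) *\<^sub>C (x ^ n)"
proof (induction n)
  case 0
  show ?case using assms(1) by (auto simp: hopf_op_one)
next
  case (Suc n)
  show ?case
    using derivation_eigen_mult[OF assms Suc] by (simp add: algebra_simps)
qed

lemma derivation_eigen_int_pow: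
  assumes z: "z = gA \<or> z = gB" and x: "hopf_op z x = \<alpha> *\<^sub>C x" and inv: "x * y = 1" "y * x = 1"
  shows "hopf_op z (int_pow x y n) = (of_int n * \<alpha>) *\<^sub>C int_pow x y n"
proof -
  \<comment> \<open>Differentiating \<open>x * y = 1\<close> gives the inverse the opposite
    eigenvalue.\<close>
  have "x * hopf_op z y = - \<alpha> *\<^sub>C 1"
    using z hopf_op_mult(1,2)[of x y] x hopf_op_one[of z]
    by (auto simp: inv alg_scale_mult_left eq_neg_iff_add_eq_0 add.commute)
  then have "y * x * hopf_op z y = - \<alpha> *\<^sub>C y"
    by (simp add: mult.assoc alg_scale_mult_right)
  then have y: "hopf_op z y = - \<alpha> *\<^sub>C y" by (simp add: inv)
  show ?thesis
    using derivation_eigen_power[OF z x] derivation_eigen_power[OF z y] by (simp add: int_pow_def)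
qed

lemma K_power:
  assumes "hopf_op gK x = \<alpha> *\<^sub>C x"
  shows "hopf_op gK (x ^ n) = \<alpha> ^ n *\<^sub>C x ^ n"
  by (induction n) (simp_all add: hopf_op_KK hopf_op_mult assms alg_scale_mult_left
      alg_scale_mult_right mult.commute)

lemma K_dhat_inv: "hopf_op gK dhat_inv = - dhat_inv"
proof -
  have "- dhat * hopf_op gK dhat_inv = 1"
    using hopf_op_mult(5)[of dhat dhat_inv] by (simp add: S14o_relations hopf_op_KK hopf_op_gen)
  then have "dhat * hopf_op gK dhat_inv = - 1" by (metis minus_minus mult_minus_left)
  then have "dhat_inv * (dhat * hopf_op gK dhat_inv) = dhat_inv * - 1" by (rule arg_cong)
  then show ?thesis by simp
qed

lemma K_dpow: "hopf_op gK (int_pow dhat dhat_inv n) =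
  (-1) ^ nat \<bar>n\<bar> *\<^sub>C int_pow dhat dhat_inv n"
  using K_power[of dhat "-1"] K_power[of dhat_inv "-1"]
  by (simp add: int_pow_def hopf_op_gen K_dhat_inv abs_if)

lemma K_wpow: "hopf_op gK (int_pow omega omega_inv n) = int_pow omega omega_inv n"
proof -
  have "omega * hopf_op gK omega_inv = 1"
    using hopf_op_mult(5)[of omega omega_inv] by (simp add: S14o_relations hopf_op_KK K_omega)
  then have "omega_inv * omega * hopf_op gK omega_inv = omega_inv" by (simp add: mult.assoc)
  then have "hopf_op gK omega_inv = omega_inv" by (simp add: S14o_relations)
  then show ?thesis
    using K_power[of omega 1] K_power[of omega_inv 1] by (simp add: int_pow_def K_omega)
qed

lemma K_bpow: "hopf_op gK (bhat ^ l) = (-1) ^ l *\<^sub>C bhat ^ l"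
  using K_power[of bhat "-1"] by (simp add: hopf_op_gen)

lemma skew_annihilate_power:
  assumes z: "z = gXp \<or> z = gXm" and x: "hopf_op z x = 0"
  shows "hopf_op z (x ^ n) = 0"
  using z x by (induction n) (auto simp: hopf_op_one hopf_op_mult)

lemma skew_annihilate_int_pow:
  assumes z: "z = gXp \<or> z = gXm" and x: "hopf_op z x = 0" and inv: "x * y = 1" "y * x = 1"
    and K: "hopf_op gK x = x \<or> hopf_op gK x = - x"
  shows "hopf_op z (int_pow x y n) = 0"
proof -
  have "hopf_op gK x * hopf_op z y = 0"
    using z hopf_op_mult(3,4)[of x y] x hopf_op_one[of z] by (auto simp: inv)
  then have "x * hopf_op z y = 0" using K by auto
  then have "y * x * hopf_op z y = 0" by (simp add: mult.assoc)
  then show ?thesis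
    using skew_annihilate_power[OF z x] skew_annihilate_power[OF z, of y]
    by (simp add: int_pow_def inv)
qed

text \<open>For X+ and X- the contributions of ad and bc cancel, because c anticommutes with d and a
  with b. Under B the weights within each product cancel.\<close>

lemma omega_op:
  "hopf_op gA omega = (-2) *\<^sub>C omega" "hopf_op gB omega = 0"
  "hopf_op gXp omega = 0" "hopf_op gXm omega = 0"
  by (simp_all add: omega_def hopf_op_mult hopf_op_linear hopf_op_gen scale_minus_2 scale_2
      S14o_relations algebra_simps)

lemma u_vec_A:
  assumes "even (\<rho> - \<nu>)"
  shows "hopf_op gA (u_vec \<nu> \<rho> l) = (- of_int \<rho>) *\<^sub>C u_vec \<nu> \<rho> l"
proof -
  \<comment> \<open>Evenness makes the division by 2 exact, so that the weights of the three factors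
    add up to \<open>- \<rho>\<close>.\<close>
  from assms obtain k where "\<rho> - \<nu> = 2 * k" by (rule evenE)
  then have \<rho>: "\<rho> = \<nu> + 2 * k" by simp
  have "hopf_op gA (u_vec \<nu> \<rho> l) =
      (of_nat l * -1 + of_int (\<nu> - int l) * -1 + of_int k * -2) *\<^sub>C u_vec \<nu> \<rho> l"
    unfolding u_vec_def \<rho>
    by (intro derivation_eigen_mult derivation_eigen_power derivation_eigen_int_pow)
      (simp_all add: hopf_op_gen S14o_relations
        derivation_eigen_int_pow[OF _ omega_op(1) S14o_relations(9,10)])
  then show ?thesis by (simp add: \<rho> algebra_simps)
qed

lemma u_vec_B: "hopf_op gB (u_vec \<nu> \<rho> l) = (of_int \<nu> - 2 * of_nat l) *\<^sub>C u_vec \<nu> \<rho> l"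
proof -
  have "hopf_op gB (u_vec \<nu> \<rho> l) =
      (of_nat l * -1 + of_int (\<nu> - int l) * 1 + of_int ((\<rho> - \<nu>) div 2) * 0) *\<^sub>C u_vec \<nu> \<rho> l"
    unfolding u_vec_def
    by (intro derivation_eigen_mult derivation_eigen_power derivation_eigen_int_pow)
      (simp_all add: hopf_op_gen omega_op S14o_relations)
  then show ?thesis by (simp add: algebra_simps)
qed

lemma u_vec_K:
  assumes "even (\<rho> - \<nu>)"
  shows "hopf_op gK (u_vec \<nu> \<rho> l) = (if even \<rho> then 1 else -1) *\<^sub>C u_vec \<nu> \<rho> l"
proof -
  have "even (nat \<bar>\<nu> - int l\<bar>) \<longleftrightarrow> even (\<nu> - int l)"
    by (simp add: even_nat_iff)
  \<comment> \<open>The two exponents add up to the parity of \<nu>, which is that of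
    \<rho>.\<close>
  then have "(-1) ^ l * (-1) ^ nat \<bar>\<nu> - int l\<bar> = (if even \<rho> then 1 else -1 :: complex)"
    using assms by (auto simp: uminus_power_if)
  then show ?thesis
    by (simp add: u_vec_def hopf_op_mult K_bpow K_dpow K_wpow alg_scale_mult_left
        alg_scale_mult_right mult.commute)
qed

section \<open>Reordering b and d, and the action of X+ and X- on u\<close>

lemma dhat_bpow: "dhat * bhat ^ l = (-1) ^ l *\<^sub>C (bhat ^ l * dhat)"
proof (induction l)
  case (Suc l)
  have "dhat * bhat = - (bhat * dhat)" by (simp add: S14o_relations)
  then have "dhat * bhat ^ Suc l = - (bhat * (dhat * bhat ^ l))"
    by (simp flip: mult.assoc)
  then show ?case by (simp add: Suc alg_scale_mult_right mult.assoc)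
qed simp

lemma dhat_inv_bpow: "dhat_inv * bhat ^ l = (-1) ^ l *\<^sub>C (bhat ^ l * dhat_inv)"
proof -
  have "dhat_inv * (bhat ^ l * dhat) * dhat_inv = dhat_inv * ((-1) ^ l *\<^sub>C (dhat * bhat ^ l)) * dhat_inv"
    by (simp add: dhat_bpow flip: power_add)
  then show ?thesis
    by (simp add: mult.assoc S14o_relations alg_scale_mult_left alg_scale_mult_right)
qed

text \<open>Replacing one b by d costs a sign for every b to its left, from K, and for every b to
  its right, when d is moved to the end. All \<open>Suc l\<close> summands thus carry the same sign
  \<open>(-1) ^ l\<close>.\<close>

lemma Xp_bpow: "hopf_op gXp (bhat ^ Suc l) = ((-1) ^ l * of_nat (Suc l)) *\<^sub>C (bhat ^ l * dhat)"
proof (induction l)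
  case 0
  show ?case by (simp add: hopf_op_gen)
next
  case (Suc l)
  have "hopf_op gXp (bhat ^ Suc (Suc l)) = dhat * bhat ^ Suc l - bhat * hopf_op gXp (bhat ^ Suc l)"
    by (subst power_Suc) (simp only: hopf_op_mult hopf_op_gen, simp)
  also have "\<dots> = ((-1) ^ Suc l - (-1) ^ l * of_nat (Suc l)) *\<^sub>C (bhat ^ Suc l * dhat)"
    by (subst Suc, subst dhat_bpow)
      (simp add: alg_scale_mult_right mult.assoc alg_vs.scale_left_diff_distrib)
  also have "(-1) ^ Suc l - (-1) ^ l * of_nat (Suc l) = ((-1) ^ Suc l * of_nat (Suc (Suc l)) :: complex)"
    by (simp add: algebra_simps)
  finally show ?case .
qed

text \<open>The sign from K and the sign from moving b past d cancel, so X- differentiates powers of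
  d like an ordinary derivation; the induction runs in both directions from 0.\<close>

lemma Xm_dpow: "hopf_op gXm (int_pow dhat dhat_inv n) =
  of_int n *\<^sub>C (bhat * int_pow dhat dhat_inv (n - 1))"
proof -
  have di_b: "dhat_inv * (bhat * x) = - (bhat * (dhat_inv * x))" for x
    using dhat_inv_bpow[of 1] by (simp flip: mult.assoc)
  have d_b: "dhat * (bhat * x) = - (bhat * (dhat * x))" for x
    using dhat_bpow[of 1] by (simp flip: mult.assoc)
  \<comment> \<open>The value on the inverse of d comes from applying X- to
    \<open>dhat * dhat_inv = 1\<close>.\<close>
  have "dhat * hopf_op gXm dhat_inv = bhat * dhat_inv"
    using hopf_op_mult(4)[of dhat dhat_inv] by (simp add: S14o_relations hopf_op_one hopf_op_gen)
  then have "dhat_inv * (dhat * hopf_op gXm dhat_inv) = - (bhat * (dhat_inv * dhat_inv))"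
    by (simp add: di_b)
  then have di: "hopf_op gXm dhat_inv = - (bhat * (dhat_inv * dhat_inv))" by simp
  show ?thesis
  proof (induction n rule: int_induct[where k = 0])
    case base
    show ?case by (simp add: hopf_op_one)
  next
    case (step1 n)
    have "hopf_op gXm (int_pow dhat dhat_inv (n + 1)) =
        bhat * int_pow dhat dhat_inv n - dhat * (of_int n *\<^sub>C (bhat * int_pow dhat dhat_inv (n - 1)))"
      using step1 by (simp add: dpow_Suc(1)[symmetric] hopf_op_mult hopf_op_gen)
    also have "\<dots> = of_int (n + 1) *\<^sub>C (bhat * int_pow dhat dhat_inv n)"
      by (simp add: alg_scale_mult_right d_b dpow_Suc alg_vs.scale_left_distrib)
    finally show ?case by simp
  next
    case (step2 n)
    have "hopf_op gXm (int_pow dhat dhat_inv (n - 1)) =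
        hopf_op gXm dhat_inv * int_pow dhat dhat_inv n -
        dhat_inv * (of_int n *\<^sub>C (bhat * int_pow dhat dhat_inv (n - 1)))"
      using step2 by (simp add: dpow_Suc(2)[symmetric] hopf_op_mult K_dhat_inv)
    also have "\<dots> = of_int (n - 1) *\<^sub>C (bhat * int_pow dhat dhat_inv (n - 1 - 1))"
      by (simp add: alg_scale_mult_right di di_b dpow_Suc alg_vs.scale_left_diff_distrib mult.assoc)
    finally show ?case .
  qed
qed

text \<open>X+ annihilates the powers of d and \<omega>, so only \<open>bhat ^ l\<close>
  contributes; the d it releases raises the exponent of d by one.\<close>

lemma u_vec_Xp:
  "hopf_op gXp (u_vec \<nu> \<rho> l) =
    (if l = 0 then 0 else ((-1) ^ (l - 1) * of_nat l) *\<^sub>C u_vec \<nu> \<rho> (l - 1))"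
proof -
  have "hopf_op gXp (int_pow dhat dhat_inv n) = 0" for n
    by (rule skew_annihilate_int_pow) (simp_all add: hopf_op_gen S14o_relations)
  moreover have "hopf_op gXp (int_pow omega omega_inv n) = 0" for n
    by (rule skew_annihilate_int_pow) (simp_all add: omega_op K_omega S14o_relations)
  ultimately have eq: "hopf_op gXp (u_vec \<nu> \<rho> l) = hopf_op gXp (bhat ^ l) *
      int_pow dhat dhat_inv (\<nu> - int l) * int_pow omega omega_inv ((\<rho> - \<nu>) div 2)"
    by (simp add: u_vec_def hopf_op_mult)
  show ?thesis
  proof (cases l)
    case 0
    then show ?thesis using eq by (simp add: hopf_op_one)
  next
    case (Suc k)
    have "dhat * int_pow dhat dhat_inv (\<nu> - int (Suc k)) = int_pow dhat dhat_inv (\<nu> - int k)"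
      by (simp add: dpow_Suc)
    then have "bhat ^ k * dhat * int_pow dhat dhat_inv (\<nu> - int (Suc k)) =
        bhat ^ k * int_pow dhat dhat_inv (\<nu> - int k)"
      by (simp add: mult.assoc)
    then show ?thesis
      unfolding eq unfolding Suc Xp_bpow by (simp add: alg_scale_mult_left u_vec_def)
  qed
qed

text \<open>X- annihilates the powers of b and \<omega>, so only the power of d contributes, with
  the sign that K gives to \<open>bhat ^ l\<close>.\<close>

lemma u_vec_Xm:
  "hopf_op gXm (u_vec \<nu> \<rho> l) = ((-1) ^ (l + 1) * (of_nat l - of_int \<nu>)) *\<^sub>C u_vec \<nu> \<rho> (l + 1)"
proof -
  have "hopf_op gXm (bhat ^ l) = 0"
    by (rule skew_annihilate_power) (simp_all add: hopf_op_gen)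
  moreover have "hopf_op gXm (int_pow omega omega_inv n) = 0" for n
    by (rule skew_annihilate_int_pow) (simp_all add: omega_op K_omega S14o_relations)
  ultimately have "hopf_op gXm (u_vec \<nu> \<rho> l) = ((-1) ^ l * of_int (\<nu> - int l)) *\<^sub>C
      (bhat ^ l * bhat * int_pow dhat dhat_inv (\<nu> - int l - 1) *
        int_pow omega omega_inv ((\<rho> - \<nu>) div 2))"
    by (simp add: u_vec_def hopf_op_mult K_bpow Xm_dpow alg_scale_mult_left alg_scale_mult_right
        mult.assoc)
  also have "bhat ^ l * bhat = bhat ^ (l + 1)"
    by (simp add: power_commutes)
  finally show ?thesis by (simp add: u_vec_def algebra_simps)
qed

text \<open>The sign \<open>(-1)^(l(l-1)/2)\<close> that arises on reordering
  \<open>(bhat * dhat_inv) ^ l\<close> into \<open>bhat ^ l * dhat_inv ^ l\<close>.\<close>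

definition vsign :: "nat \<Rightarrow> complex" where
  "vsign l = (\<Prod>i<l. (-1) ^ i)"

lemma vsign_simps [simp]: "vsign 0 = 1" "vsign (Suc l) = (-1) ^ l * vsign l"
  by (simp_all add: vsign_def mult.commute)

lemma vsign_square [simp]: "vsign l * vsign l = 1"
  by (induction l) (simp_all add: algebra_simps flip: power_add)

lemma vsign_nonzero [simp]: "vsign l \<noteq> 0"
  using vsign_square[of l] by fastforce

lemma v_vec_eq: "v_vec \<nu> \<rho> l = vsign l *\<^sub>C u_vec \<nu> \<rho> l"
proof -
  have di: "dhat_inv ^ l * bhat = (-1) ^ l *\<^sub>C (bhat * dhat_inv ^ l)" for l
  proof (induction l)
    case (Suc l)
    have "dhat_inv * (bhat * x) = - (bhat * (dhat_inv * x))" for x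
      using dhat_inv_bpow[of 1] by (simp flip: mult.assoc)
    with Suc show ?case by (simp add: mult.assoc alg_scale_mult_right)
  qed simp
  have eta: "(bhat * dhat_inv) ^ l = vsign l *\<^sub>C (bhat ^ l * dhat_inv ^ l)"
  proof (induction l)
    case (Suc l)
    have "(bhat * dhat_inv) ^ Suc l = (bhat * dhat_inv) ^ l * bhat * dhat_inv"
      by (simp only: power_Suc2 mult.assoc)
    also have "\<dots> = vsign l *\<^sub>C (bhat ^ l * (dhat_inv ^ l * bhat) * dhat_inv)"
      by (simp add: Suc alg_scale_mult_left mult.assoc)
    also have "\<dots> = vsign (Suc l) *\<^sub>C (bhat ^ l * bhat * (dhat_inv ^ l * dhat_inv))"
      by (simp add: di alg_scale_mult_left alg_scale_mult_right mult.assoc mult.commute)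
    finally show ?case by (simp only: power_Suc2)
  qed simp
  have "dhat_inv ^ l * int_pow dhat dhat_inv \<nu> = int_pow dhat dhat_inv (\<nu> - int l)"
  proof (induction l)
    case (Suc l)
    then show ?case by (simp add: mult.assoc dpow_Suc algebra_simps)
  qed simp
  then show ?thesis
    by (simp add: v_vec_def u_vec_def eta alg_scale_mult_left mult.assoc)
qed

text \<open>Consecutive values of \<open>vsign\<close> differ by the alternating sign in the
  formulas for u, which therefore disappears.\<close>

lemma v_vec_op:
  assumes "even (\<rho> - \<nu>)"
  shows "hopf_op gA (v_vec \<nu> \<rho> l) = (- of_int \<rho>) *\<^sub>C v_vec \<nu> \<rho> l"
    and "hopf_op gB (v_vec \<nu> \<rho> l) = (of_int \<nu> - 2 * of_nat l) *\<^sub>C v_vec \<nu> \<rho> l"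
    and "hopf_op gXp (v_vec \<nu> \<rho> l) = (if l = 0 then 0 else of_nat l *\<^sub>C v_vec \<nu> \<rho> (l - 1))"
    and "hopf_op gXm (v_vec \<nu> \<rho> l) = (of_int \<nu> - of_nat l) *\<^sub>C v_vec \<nu> \<rho> (l + 1)"
proof -
  show "hopf_op gA (v_vec \<nu> \<rho> l) = (- of_int \<rho>) *\<^sub>C v_vec \<nu> \<rho> l"
    and "hopf_op gB (v_vec \<nu> \<rho> l) = (of_int \<nu> - 2 * of_nat l) *\<^sub>C v_vec \<nu> \<rho> l"
    by (simp_all add: v_vec_eq hopf_op_linear u_vec_A[OF assms] u_vec_B mult.commute)
  have sign: "(-1) ^ l * ((-1) ^ l * c) = (c::complex)" for c
    by (simp flip: mult.assoc power_add)
  show "hopf_op gXp (v_vec \<nu> \<rho> l) = (if l = 0 then 0 else of_nat l *\<^sub>C v_vec \<nu> \<rho> (l - 1))"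
  proof (cases l)
    case (Suc k)
    have "(-1) ^ k * ((-1) ^ k * c) = (c::complex)" for c
      by (simp flip: mult.assoc power_add)
    then show ?thesis by (simp add: Suc v_vec_eq hopf_op_linear u_vec_Xp algebra_simps)
  qed (simp add: v_vec_eq hopf_op_linear u_vec_Xp)
  show "hopf_op gXm (v_vec \<nu> \<rho> l) = (of_int \<nu> - of_nat l) *\<^sub>C v_vec \<nu> \<rho> (l + 1)"
    by (simp add: v_vec_eq hopf_op_linear u_vec_Xm algebra_simps)
qed

section \<open>The representation on formal power series\<close>

text \<open>The formulas for u read on coefficients: coefficient n of the X+ image comes from index
  n + 1, that of the X- image from n - 1. K acts by the parity of the A-weight
  \<open>- \<rho>\<close>.\<close>

fun fps_op :: "int \<Rightarrow> int \<Rightarrow> hopf_gen \<Rightarrow> complex fps \<Rightarrow> complex fps" where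
  "fps_op \<nu> \<rho> gA f = fps_scale (- of_int \<rho>) f"
| "fps_op \<nu> \<rho> gB f = Abs_fps (\<lambda>n. (of_int \<nu> - 2 * of_nat n) * fps_nth f n)"
| "fps_op \<nu> \<rho> gXp f = Abs_fps (\<lambda>n. (-1) ^ n * of_nat (Suc n) * fps_nth f (Suc n))"
| "fps_op \<nu> \<rho> gXm f = Abs_fps (\<lambda>n. if n = 0 then 0
      else (-1) ^ n * (of_nat (n - 1) - of_int \<nu>) * fps_nth f (n - 1))"
| "fps_op \<nu> \<rho> gK f = fps_scale (if even \<rho> then 1 else -1) f"

lemma fps_op_add: "fps_op \<nu> \<rho> z (f + g) = fps_op \<nu> \<rho> z f + fps_op \<nu> \<rho> z g"
  by (cases z) (simp_all add: fps_eq_iff algebra_simps)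

lemma fps_op_scale: "fps_op \<nu> \<rho> z (fps_scale c f) = fps_scale c (fps_op \<nu> \<rho> z f)"
  by (cases z) (simp_all add: fps_eq_iff)

global_interpretation rep: generator_ops fps_scale "fps_op \<nu> \<rho>" for \<nu> \<rho>
  by unfold_locales (simp_all add: fps_op_add fps_op_scale)

abbreviation u_span :: "int \<Rightarrow> int \<Rightarrow> S14o_ext set" where
  "u_span \<nu> \<rho> \<equiv> alg_vs.span (range (u_vec \<nu> \<rho>))"

lemma u_vec_in_u_span [simp]: "u_vec \<nu> \<rho> l \<in> u_span \<nu> \<rho>"
  by (simp add: alg_vs.span_base)

lemma fps_op_X_power:
  "fps_op \<nu> \<rho> gA (fps_X ^ l) = fps_scale (- of_int \<rho>) (fps_X ^ l)"
  "fps_op \<nu> \<rho> gB (fps_X ^ l) = fps_scale (of_int \<nu> - 2 * of_nat l) (fps_X ^ l)"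
  "fps_op \<nu> \<rho> gXp (fps_X ^ l) =
    (if l = 0 then 0 else fps_scale ((-1) ^ (l - 1) * of_nat l) (fps_X ^ (l - 1)))"
  "fps_op \<nu> \<rho> gXm (fps_X ^ l) =
    fps_scale ((-1) ^ (l + 1) * (of_nat l - of_int \<nu>)) (fps_X ^ (l + 1))"
  "fps_op \<nu> \<rho> gK (fps_X ^ l) = fps_scale (if even \<rho> then 1 else -1) (fps_X ^ l)"
  by (auto simp: fps_eq_iff fps_X_power_nth gr0_conv_Suc)

lemma hopf_op_u_vec:
  assumes "even (\<rho> - \<nu>)"
  shows "hopf_op z (u_vec \<nu> \<rho> l) \<in> u_span \<nu> \<rho>"
    and "\<Phi> (hopf_op z (u_vec \<nu> \<rho> l)) = fps_op \<nu> \<rho> z (fps_X ^ l)"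
proof -
  show "hopf_op z (u_vec \<nu> \<rho> l) \<in> u_span \<nu> \<rho>"
    by (cases z) (simp_all add: u_vec_A[OF assms] u_vec_B u_vec_Xp u_vec_Xm u_vec_K[OF assms]
        alg_vs.span_scale alg_vs.span_zero alg_vs.span_neg del: of_nat_Suc)
  show "\<Phi> (hopf_op z (u_vec \<nu> \<rho> l)) = fps_op \<nu> \<rho> z (fps_X ^ l)"
    by (cases z) (simp_all only: u_vec_A[OF assms] u_vec_B u_vec_Xp u_vec_Xm u_vec_K[OF assms]
        fps_op_X_power \<Phi>_scale \<Phi>_u_vec \<Phi>.zero if_distrib[of \<Phi>])
qed

lemma hopf_op_u_span:
  assumes "even (\<rho> - \<nu>)" "x \<in> u_span \<nu> \<rho>"
  shows "hopf_op z x \<in> u_span \<nu> \<rho> \<and> \<Phi> (hopf_op z x) = fps_op \<nu> \<rho> z (\<Phi> x)"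
  using assms(2)
proof (induction rule: alg_vs.span_induct_alt)
  case base
  show ?case
    using fps_op_scale[of \<nu> \<rho> z 0 0] by (simp add: hopf_op_linear alg_vs.span_zero \<Phi>.zero)
next
  case (step c x y)
  then obtain l where "x = u_vec \<nu> \<rho> l" by auto
  with step show ?case
    using hopf_op_u_vec[OF assms(1)]
    by (simp add: hopf_op_linear alg_vs.span_add alg_vs.span_scale \<Phi>_add \<Phi>_scale \<Phi>_u_vec
        fps_op_add fps_op_scale)
qed

lemma act_free_u_span:
  assumes "even (\<rho> - \<nu>)" "x \<in> u_span \<nu> \<rho>"
  shows "hopf.act_free p x \<in> u_span \<nu> \<rho> \<and> \<Phi> (hopf.act_free p x) = rep.act_free \<nu> \<rho> p (\<Phi> x)"
proof (induction p rule: free_induct)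
  case (single w c)
  have "hopf.act_word w x \<in> u_span \<nu> \<rho> \<and> \<Phi> (hopf.act_word w x) = rep.act_word \<nu> \<rho> w (\<Phi> x)"
  proof (induction w)
    case (Cons z w)
    then show ?case using hopf_op_u_span[OF assms(1), of "hopf.act_word w x" z] by simp
  qed (simp add: assms)
  then show ?case by (simp add: alg_vs.span_scale \<Phi>_scale)
next
  case (add p q)
  then show ?case
    by (simp add: hopf.act_free_plus rep.act_free_plus alg_vs.span_add \<Phi>_add)
qed

lemma piL_abs: "piL (abs_alg p) x = hopf.act_free p x"
  by (simp add: piL_eq hopf.act_alg_abs)

lemma series_piL_u_vec:
  assumes "even (\<rho> - \<nu>)"
  shows "piL (abs_alg p) (u_vec \<nu> \<rho> l) \<in> u_span \<nu> \<rho>"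
    and "series \<nu> \<rho> (piL (abs_alg p) (u_vec \<nu> \<rho> l)) = rep.act_free \<nu> \<rho> p (fps_X ^ l)"
  using act_free_u_span[OF assms, of "u_vec \<nu> \<rho> l"] by (simp_all add: piL_abs series_eq_\<Phi> \<Phi>_u_vec)

lemma series_u_vec: "series \<nu> \<rho> (u_vec \<nu> \<rho> l) = fps_X ^ l"
  by (simp add: series_eq_\<Phi> \<Phi>_u_vec)

section \<open>Continuity of the action and termwise convergence\<close>

lemma fps_op_local:
  assumes "\<And>k. k \<le> Suc n \<Longrightarrow> fps_nth f k = 0"
  shows "fps_nth (fps_op \<nu> \<rho> z f) n = 0"
  by (cases z) (simp_all add: assms)

lemma act_word_local:
  assumes "\<And>k. k \<le> n + length w \<Longrightarrow> fps_nth f k = 0"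
  shows "fps_nth (rep.act_word \<nu> \<rho> w f) n = 0"
  using assms
proof (induction w arbitrary: n)
  case (Cons z w)
  then show ?case by (auto intro!: fps_op_local)
qed simp

text \<open>Each letter looks at most one coefficient ahead, so any bound on the lengths of the
  words in \<open>p\<close> serves as \<open>N\<close>.\<close>

lemma act_free_local:
  "\<exists>N. \<forall>f n. (\<forall>k\<le>n + N. fps_nth f k = 0) \<longrightarrow> fps_nth (rep.act_free \<nu> \<rho> p f) n = 0"
proof (induction p rule: free_induct)
  case (single w c)
  show ?case by (intro exI[of _ "length w"]) (simp add: act_word_local)
next
  case (add p q)
  then obtain N M
    where "\<forall>f n. (\<forall>k\<le>n + N. fps_nth f k = 0) \<longrightarrow> fps_nth (rep.act_free \<nu> \<rho> p f) n = 0"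
      "\<forall>f n. (\<forall>k\<le>n + M. fps_nth f k = 0) \<longrightarrow> fps_nth (rep.act_free \<nu> \<rho> q f) n = 0"
    by blast
  then show ?case
    by (intro exI[of _ "max N M"]) (auto simp: rep.act_free_plus)
qed

lemma fps_nth_partial_sum:
  "fps_nth (\<Sum>l<m. fps_scale (c l) (fps_X ^ l)) k = (if k < m then c k else 0)"
proof -
  have "fps_nth (\<Sum>l<m. fps_scale (c l) (fps_X ^ l)) k = (\<Sum>l<m. if k = l then c l else 0)"
    unfolding fps_sum_nth by (rule sum.cong) (simp_all add: fps_X_power_nth)
  then show ?thesis by simp
qed

text \<open>Convergence of formal power series means that each coefficient is eventually
  constant.\<close>

lemma sums_X_power_iff: "(\<lambda>l. fps_scale (c l) (fps_X ^ l)) sums f \<longleftrightarrow> c = fps_nth f"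
proof
  assume "(\<lambda>l. fps_scale (c l) (fps_X ^ l)) sums f"
  then have "\<forall>\<^sub>F m in sequentially. fps_nth (\<Sum>l<m. fps_scale (c l) (fps_X ^ l)) k = fps_nth f k" for k
    unfolding sums_def tendsto_fps_iff by blast
  then have "\<forall>\<^sub>F m in sequentially. (if k < m then c k else 0) = fps_nth f k" for k
    unfolding fps_nth_partial_sum .
  note ev = this
  show "c = fps_nth f"
  proof (rule ext)
    fix k
    have "\<forall>\<^sub>F m in sequentially. c k = fps_nth f k"
      using ev[of k] eventually_gt_at_top[of k] by eventually_elim simp
    then show "c k = fps_nth f k" by simp
  qed
next
  assume c: "c = fps_nth f"
  show "(\<lambda>l. fps_scale (c l) (fps_X ^ l)) sums f"
    unfolding sums_def c
  proof (rule tendsto_fpsI)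
    fix k
    show "\<forall>\<^sub>F m in sequentially. fps_nth (\<Sum>l<m. fps_scale (fps_nth f l) (fps_X ^ l)) k = fps_nth f k"
      unfolding fps_nth_partial_sum using eventually_gt_at_top[of k] by eventually_elim simp
  qed
qed

lemma termwise_sums:
  assumes "even (\<rho> - \<nu>)"
  shows "termwise \<nu> \<rho> (abs_alg p) f sums rep.act_free \<nu> \<rho> p f"
  unfolding sums_def
proof (rule tendsto_fpsI)
  fix n
  obtain N where N: "\<And>f n. (\<And>k. k \<le> n + N \<Longrightarrow> fps_nth f k = 0) \<Longrightarrow>
      fps_nth (rep.act_free \<nu> \<rho> p f) n = 0"
    using act_free_local by blast
  \<comment> \<open>On partial sums the action and the termwise action agree by linearity; only the
    tail needs continuity.\<close>
  have sum: "rep.act_free \<nu> \<rho> p (\<Sum>l<m. fps_scale (fps_nth f l) (fps_X ^ l)) =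
      (\<Sum>l<m. termwise \<nu> \<rho> (abs_alg p) f l)" for m
    by (induction m) (simp_all add: rep.act_free_add rep.act_free_scale termwise_def
        series_piL_u_vec[OF assms])
  have "\<forall>\<^sub>F m in sequentially. n + N < m" by (rule eventually_gt_at_top)
  then show "\<forall>\<^sub>F m in sequentially. fps_nth (\<Sum>l<m. termwise \<nu> \<rho> (abs_alg p) f l) n =
      fps_nth (rep.act_free \<nu> \<rho> p f) n"
  proof eventually_elim
    case (elim m)
    let ?g = "\<Sum>l<m. fps_scale (fps_nth f l) (fps_X ^ l)"
    \<comment> \<open>The tail vanishes up to order \<open>n + N\<close> and so cannot reach
      coefficient \<open>n\<close>.\<close>
    have "fps_nth (rep.act_free \<nu> \<rho> p (f - ?g)) n = 0"
      using elim by (intro N) (simp add: fps_nth_partial_sum)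
    moreover have "rep.act_free \<nu> \<rho> p f = rep.act_free \<nu> \<rho> p (f - ?g) + rep.act_free \<nu> \<rho> p ?g"
      by (simp flip: rep.act_free_add)
    ultimately show ?case by (simp add: sum)
  qed
qed

section \<open>The representation on power series\<close>

lemma C_rep_simps [simp]:
  "vcarrier (C_rep \<nu> \<rho>) = UNIV" "vzero (C_rep \<nu> \<rho>) = 0" "vadd (C_rep \<nu> \<rho>) = (+)"
  "vscale (C_rep \<nu> \<rho>) = fps_scale" "vtop (C_rep \<nu> \<rho>) = euclidean"
  by (simp_all add: C_rep_def)

text \<open>The left side depends only on the class of \<open>p\<close>, so the operators
  \<open>fps_op\<close> inherit the relations of s14o from \<open>piL\<close>.\<close>

lemma C_rep_act:
  assumes "even (\<rho> - \<nu>)"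
  shows "act (C_rep \<nu> \<rho>) (abs_alg p) f = rep.act_free \<nu> \<rho> p f"
  using sums_unique[OF termwise_sums[OF assms]] by (simp add: C_rep_def)

lemma C_rep_act_gen:
  assumes "even (\<rho> - \<nu>)"
  shows "act (C_rep \<nu> \<rho>) (monom [z]) f = fps_op \<nu> \<rho> z f"
  by (simp add: monom_abs C_rep_act[OF assms])

lemma C_rep_act_linear:
  assumes "even (\<rho> - \<nu>)"
  shows "act (C_rep \<nu> \<rho>) Z (f + g) = act (C_rep \<nu> \<rho>) Z f + act (C_rep \<nu> \<rho>) Z g"
    and "act (C_rep \<nu> \<rho>) Z (fps_scale c f) = fps_scale c (act (C_rep \<nu> \<rho>) Z f)"
    and "act (C_rep \<nu> \<rho>) (Z + Z') f = act (C_rep \<nu> \<rho>) Z f + act (C_rep \<nu> \<rho>) Z' f"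
    and "act (C_rep \<nu> \<rho>) (c *\<^sub>C Z) f = fps_scale c (act (C_rep \<nu> \<rho>) Z f)"
    and "act (C_rep \<nu> \<rho>) 1 f = f"
    and "act (C_rep \<nu> \<rho>) (Z * Z') f = act (C_rep \<nu> \<rho>) Z (act (C_rep \<nu> \<rho>) Z' f)"
  by (cases Z; cases Z'; simp add: C_rep_act[OF assms] plus_alg.abs_eq times_alg.abs_eq
      alg_scale.abs_eq one_alg_def rep.act_free_add rep.act_free_scale rep.act_free_plus
      rep.act_free_mult)+

text \<open>The relation between K and A modulo \<open>W\<close>, used with zero and with
  \<open>E_space\<close>. A acts by \<open>- \<rho>\<close>, so either \<open>n = - \<rho>\<close>,
  where the parities agree, or \<open>f\<close> lies in \<open>W\<close>.\<close>

lemma K_clause: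
  assumes "fps_op \<nu> \<rho> gA f - fps_scale (of_int n) f \<in> W" "fps_vs.subspace W"
  shows "fps_op \<nu> \<rho> gK f - fps_scale (if even n then 1 else -1) f \<in> W"
proof (cases "n = - \<rho>")
  case True
  then show ?thesis using assms(2) by (simp add: fps_vs.subspace_0)
next
  case False
  have "fps_op \<nu> \<rho> gA f - fps_scale (of_int n) f = fps_scale (- of_int (\<rho> + n)) f"
    by (simp add: fps_eq_iff algebra_simps)
  then have "fps_scale (- of_int (\<rho> + n)) f \<in> W" using assms(1) by simp
  then have "fps_scale (- 1 / of_int (\<rho> + n)) (fps_scale (- of_int (\<rho> + n)) f) \<in> W"
    by (rule fps_vs.subspace_scale[OF assms(2)])
  moreover have "of_int (\<rho> + n) \<noteq> (0 :: complex)"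
    using False by (simp only: of_int_eq_0_iff)
  ultimately have "f \<in> W" by (simp del: of_int_add)
  then show ?thesis
    unfolding fps_op.simps by (intro fps_vs.subspace_diff fps_vs.subspace_scale assms(2))
qed

lemma vspace_C_rep: "vspace (C_rep \<nu> \<rho>)"
  unfolding vspace_def
  by (auto simp: algebra_simps fps_vs.scale_right_distrib fps_vs.scale_left_distrib
      intro!: exI[of _ "- _"])

lemma representation_C_rep:
  assumes "even (\<rho> - \<nu>)"
  shows "representation (C_rep \<nu> \<rho>)"
  using K_clause[where W = "{0}" and \<nu> = \<nu> and \<rho> = \<rho>] fps_vs.subspace_single_0
  unfolding representation_def
  by (simp add: vspace_C_rep C_rep_act_linear[OF assms] C_rep_act_gen[OF assms] del: fps_op.simps)

section \<open>Closed invariant subspaces\<close>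

lemma X_power_in_closed_invariant:
  assumes W: "fps_vs.subspace W" "closed W" and B: "\<And>f. f \<in> W \<Longrightarrow> fps_op \<nu> \<rho> gB f \<in> W"
    and f: "f \<in> W" "fps_nth f l \<noteq> 0"
  shows "fps_X ^ l \<in> W"
proof -
  \<comment> \<open>\<open>P m\<close> applies the factors for all \<open>k < m\<close> except
    \<open>k = l\<close>. As the weights of l and k differ by \<open>2 (k - l)\<close>, factor k
    leaves coefficient l alone and kills coefficient k.\<close>
  define P where "P = rec_nat f (\<lambda>k g. if k = l then g else
    fps_scale (1 / (2 * (of_nat k - of_nat l)))
      (fps_op \<nu> \<rho> gB g - fps_scale (of_int \<nu> - 2 * of_nat k) g))"
  have P_simps: "P 0 = f" "P (Suc k) = (if k = l then P k else
      fps_scale (1 / (2 * (of_nat k - of_nat l)))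
        (fps_op \<nu> \<rho> gB (P k) - fps_scale (of_int \<nu> - 2 * of_nat k) (P k)))" for k
    by (simp_all add: P_def)
  have nth: "fps_nth (P (Suc k)) n = (if k = l then fps_nth (P k) n else
      (of_nat k - of_nat n) / (of_nat k - of_nat l) * fps_nth (P k) n)" for k n
  proof (cases "k = l")
    case False
    let ?x = "fps_nth (P k) n"
    have cancel: "1 / (2 * a) * (2 * (b * x)) = b / a * x" for a b x :: complex
      by simp
    have "fps_nth (P (Suc k)) n = 1 / (2 * (of_nat k - of_nat l)) *
        ((of_int \<nu> - 2 * of_nat n) * ?x - (of_int \<nu> - 2 * of_nat k) * ?x)"
      using False by (simp only: P_simps(2) if_False fps_nth_scale fps_sub_nth fps_op.simps
          fps_nth_Abs_fps)
    also have "(of_int \<nu> - 2 * of_nat n) * ?x - (of_int \<nu> - 2 * of_nat k) * ?x =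
        2 * ((of_nat k - of_nat n) * ?x)"
      by (simp add: algebra_simps)
    finally show ?thesis unfolding cancel using False by simp
  qed (simp add: P_simps(2))
  have P_in: "P m \<in> W" for m
    by (induction m)
      (auto simp: P_simps f intro!: fps_vs.subspace_scale fps_vs.subspace_diff W B simp del: fps_op.simps)
  have P_l: "fps_nth (P m) l = fps_nth f l" for m
    by (induction m) (auto simp: P_simps(1) nth)
  have P_0: "fps_nth (P m) n = 0" if "n < m" "n \<noteq> l" for m n
    using that by (induction m) (auto simp: nth less_Suc_eq)
  \<comment> \<open>Coefficient \<open>n\<close> is final once the factor for index n has been
    applied, which is convergence of formal power series.\<close>
  have "P \<longlonglongrightarrow> fps_scale (fps_nth f l) (fps_X ^ l)"
  proof (rule tendsto_fpsI)
    fix n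
    show "\<forall>\<^sub>F m in sequentially. fps_nth (P m) n = fps_nth (fps_scale (fps_nth f l) (fps_X ^ l)) n"
      using eventually_gt_at_top[of n]
      by eventually_elim (auto simp: P_l P_0 fps_X_power_nth)
  qed
  then have "fps_scale (fps_nth f l) (fps_X ^ l) \<in> W"
    using closed_sequentially[OF W(2)] P_in by blast
  then have "fps_scale (1 / fps_nth f l) (fps_scale (fps_nth f l) (fps_X ^ l)) \<in> W"
    by (rule fps_vs.subspace_scale[OF W(1)])
  then show ?thesis using f(2) by simp
qed

text \<open>The coefficient with which X+ lowers the index is nonzero at every positive
  index.\<close>

lemma X_power_down:
  assumes W: "fps_vs.subspace W" and Xp: "\<And>f. f \<in> W \<Longrightarrow> fps_op \<nu> \<rho> gXp f \<in> W"
    and l: "fps_X ^ l \<in> W" and "k \<le> l"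
  shows "fps_X ^ k \<in> W"
  using \<open>k \<le> l\<close>
proof (induction rule: inc_induct)
  case base
  show ?case by (rule l)
next
  case (step n)
  have "fps_scale (1 / ((-1) ^ n * of_nat (Suc n))) (fps_op \<nu> \<rho> gXp (fps_X ^ Suc n)) \<in> W"
    by (intro fps_vs.subspace_scale W Xp step.IH)
  then show ?case unfolding fps_op_X_power by (simp del: of_nat_Suc)
qed

text \<open>The coefficient with which X- leaves index j vanishes only for
  \<open>j = \<nu>\<close>.\<close>

lemma X_power_up:
  assumes W: "fps_vs.subspace W" and Xm: "\<And>f. f \<in> W \<Longrightarrow> fps_op \<nu> \<rho> gXm f \<in> W"
    and l: "fps_X ^ l \<in> W" and "l \<le> k" and \<nu>: "\<And>j. l \<le> j \<Longrightarrow> j < k \<Longrightarrow> int j \<noteq> \<nu>"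
  shows "fps_X ^ k \<in> W"
  using \<open>l \<le> k\<close> \<nu>
proof (induction rule: dec_induct)
  case base
  show ?case by (rule l)
next
  case (step n)
  have "of_int (int n) \<noteq> (of_int \<nu> :: complex)"
    using step by (simp only: of_int_eq_iff) simp
  then have nz: "(-1) ^ (n + 1) * (of_nat n - of_int \<nu>) \<noteq> (0 :: complex)" by simp
  have "fps_scale (1 / ((-1) ^ (n + 1) * (of_nat n - of_int \<nu>)))
      (fps_op \<nu> \<rho> gXm (fps_X ^ n)) \<in> W"
    using step by (intro fps_vs.subspace_scale W Xm step.IH) simp
  then show ?case unfolding fps_op_X_power using nz by (simp only: fps_vs.scale_scale) simp
qed

text \<open>Polynomials are dense in the power series.\<close>

lemma closed_subspace_eq_UNIV:
  assumes W: "fps_vs.subspace W" "closed W" and X: "\<And>l. fps_X ^ l \<in> W"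
  shows "W = UNIV"
proof -
  have "f \<in> W" for f
  proof -
    have lim: "(\<lambda>m. \<Sum>l<m. fps_scale (fps_nth f l) (fps_X ^ l)) \<longlonglongrightarrow> f"
      using sums_X_power_iff[of "fps_nth f" f] by (simp add: sums_def)
    have "(\<Sum>l<m. fps_scale (fps_nth f l) (fps_X ^ l)) \<in> W" for m
      by (intro fps_vs.subspace_sum fps_vs.subspace_scale W X)
    then show ?thesis by (rule closed_sequentially[OF W(2) _ lim])
  qed
  then show ?thesis by blast
qed

section \<open>Irreducibility for negative \<nu>\<close>

locale invariant_fps =
  fixes \<nu> \<rho> :: int and W
  assumes W: "fps_vs.subspace W" and closed: "closed W"
    and op: "\<And>z f. f \<in> W \<Longrightarrow> fps_op \<nu> \<rho> z f \<in> W"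
begin

text \<open>The third assumption lists the ways from l to k that avoid the forbidden step from \<nu>
  to \<nu> + 1: downwards, or no such index exists, or the start lies beyond it, or the target does
  not.\<close>

lemma X_power_below:
  assumes "f \<in> W" "fps_nth f l \<noteq> 0" "k \<le> l \<or> \<nu> < 0 \<or> int l > \<nu> \<or> int k \<le> \<nu>"
  shows "fps_X ^ k \<in> W"
proof -
  have l: "fps_X ^ l \<in> W" by (rule X_power_in_closed_invariant[OF W closed _ assms(1,2)]) (rule op)
  show ?thesis
  proof (cases "k \<le> l")
    case True
    show ?thesis by (rule X_power_down[OF W _ l True]) (rule op)
  next
    case False
    with assms(3) show ?thesis
      by (intro X_power_up[where \<nu> = \<nu> and \<rho> = \<rho>, OF W _ l] op) auto
  qed
qed

lemma eq_UNIV: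
  assumes "f \<in> W" "fps_nth f l \<noteq> 0" "\<nu> < 0 \<or> int l > \<nu>"
  shows "W = UNIV"
  using assms by (intro closed_subspace_eq_UNIV W closed X_power_below[of f l]) auto

end

lemma subspace_of_C_rep: "subspace_of (C_rep \<nu> \<rho>) W \<longleftrightarrow> fps_vs.subspace W"
  by (auto simp: subspace_of_def fps_vs.subspace_def)

lemma invariant_subspace_C_rep_iff:
  assumes "even (\<rho> - \<nu>)"
  shows "invariant_subspace (C_rep \<nu> \<rho>) W \<longleftrightarrow>
    fps_vs.subspace W \<and> (\<forall>z. \<forall>f\<in>W. fps_op \<nu> \<rho> z f \<in> W)"
proof
  assume "invariant_subspace (C_rep \<nu> \<rho>) W"
  then show "fps_vs.subspace W \<and> (\<forall>z. \<forall>f\<in>W. fps_op \<nu> \<rho> z f \<in> W)"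
    using C_rep_act_gen[OF assms] by (metis invariant_subspace_def subspace_of_C_rep)
next
  assume W: "fps_vs.subspace W \<and> (\<forall>z. \<forall>f\<in>W. fps_op \<nu> \<rho> z f \<in> W)"
  have "rep.act_free \<nu> \<rho> p f \<in> W" if "f \<in> W" for p f
  proof (induction p rule: free_induct)
    case (single w c)
    have "rep.act_word \<nu> \<rho> w f \<in> W" using W that by (induction w) auto
    then show ?case using W by (simp add: fps_vs.subspace_scale)
  next
    case (add p q)
    then show ?case using W by (simp add: rep.act_free_plus fps_vs.subspace_add)
  qed
  then have "act (C_rep \<nu> \<rho>) Z f \<in> W" if "f \<in> W" for Z f
    using that by (cases Z) (simp add: C_rep_act[OF assms])
  then show "invariant_subspace (C_rep \<nu> \<rho>) W"
    using W by (simp add: invariant_subspace_def subspace_of_C_rep)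
qed

lemma invariant_fps_iff:
  assumes "even (\<rho> - \<nu>)"
  shows "invariant_fps \<nu> \<rho> W \<longleftrightarrow> invariant_subspace (C_rep \<nu> \<rho>) W \<and> closed W"
  unfolding invariant_subspace_C_rep_iff[OF assms] invariant_fps_def by auto

lemma irreducible_C_rep:
  assumes "even (\<rho> - \<nu>)" "\<nu> < 0"
  shows "irreducible_rep (C_rep \<nu> \<rho>)"
  unfolding irreducible_rep_def
proof (intro conjI allI impI)
  show "vcarrier (C_rep \<nu> \<rho>) \<noteq> {vzero (C_rep \<nu> \<rho>)}"
    unfolding C_rep_simps by (metis UNIV_I singletonD zero_neq_one)
  fix W
  assume "invariant_subspace (C_rep \<nu> \<rho>) W \<and> closedin (vtop (C_rep \<nu> \<rho>)) W"
  then interpret invariant_fps \<nu> \<rho> W by (simp add: invariant_fps_iff[OF assms(1)])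
  show "W = {vzero (C_rep \<nu> \<rho>)} \<or> W = vcarrier (C_rep \<nu> \<rho>)"
  proof (cases "\<exists>f\<in>W. f \<noteq> 0")
    case True
    then show ?thesis using eq_UNIV assms(2) by (auto simp: fps_eq_iff)
  qed (use fps_vs.subspace_0[OF W] in auto)
qed (rule representation_C_rep[OF assms(1)])

section \<open>Infinite dimension\<close>

lemma independent_X_powers: "fps_vs.independent ((\<lambda>l. fps_X ^ l) ` A)"
  unfolding fps_vs.independent_explicit_finite_subsets
proof (intro allI impI ballI)
  fix S c v
  assume S: "S \<subseteq> (\<lambda>l. fps_X ^ l) ` A" "finite S" and 0: "(\<Sum>v\<in>S. fps_scale (c v) v) = 0" and v: "v \<in> S"
  then obtain l where l: "v = fps_X ^ l" by auto
  have "c w * fps_nth w l = (if w = v then c w else 0)" if "w \<in> S" for w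
    using S(1) that by (auto simp: l fps_X_power_nth)
  then have "fps_nth (\<Sum>w\<in>S. fps_scale (c w) w) l = (\<Sum>w\<in>S. if w = v then c w else 0)"
    by (simp add: fps_sum_nth)
  then show "c v = 0" using S(2) v by (simp add: 0)
qed

lemma inj_X_power: "inj (\<lambda>l. fps_X ^ l :: complex fps)"
proof (rule injI)
  fix l m
  assume "fps_X ^ l = (fps_X ^ m :: complex fps)"
  then have "fps_nth (fps_X ^ l :: complex fps) l = fps_nth (fps_X ^ m) l" by simp
  then show "l = m" by (simp add: fps_X_power_nth split: if_splits)
qed

lemma finite_span_neq_UNIV:
  assumes "finite S"
  shows "fps_vs.span S \<noteq> UNIV"
proof
  assume "fps_vs.span S = UNIV"
  then have "finite (range (\<lambda>l. fps_X ^ l :: complex fps))"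
    using fps_vs.independent_span_bound[OF assms independent_X_powers] by auto
  then show False using finite_imageD[OF _ inj_X_power] by simp
qed

lemma infinite_dimensional_C_rep: "infinite_dimensional (C_rep \<nu> \<rho>)"
  unfolding infinite_dimensional_def subspace_of_C_rep
  using finite_span_neq_UNIV fps_vs.subspace_span fps_vs.span_superset by (metis C_rep_simps(1))

section \<open>The invariant subspace E\<close>

lemma E_space_altdef: "E_space \<nu> \<rho> = fps_vs.span ((\<lambda>l. fps_X ^ l) ` {l. int l \<le> \<nu>})"
  unfolding E_space_def by (rule arg_cong[of _ _ fps_vs.span]) (auto simp: series_u_vec)

lemma E_space_eq: "E_space \<nu> \<rho> = {f. \<forall>n. int n > \<nu> \<longrightarrow> fps_nth f n = 0}"
proof (intro equalityI subsetI)
  fix f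
  assume "f \<in> E_space \<nu> \<rho>"
  then show "f \<in> {f. \<forall>n. int n > \<nu> \<longrightarrow> fps_nth f n = 0}"
    unfolding E_space_altdef
    by (induction rule: fps_vs.span_induct_alt) (auto simp: fps_X_power_nth)
next
  fix f :: "complex fps"
  assume f: "f \<in> {f. \<forall>n. int n > \<nu> \<longrightarrow> fps_nth f n = 0}"
  \<comment> \<open>For negative \<nu> the bound is 0 and the sum empty, in accordance with E being
    zero then.\<close>
  have "f = (\<Sum>l<nat (\<nu> + 1). fps_scale (fps_nth f l) (fps_X ^ l))"
    unfolding fps_eq_iff fps_nth_partial_sum using f by auto
  also have "\<dots> \<in> E_space \<nu> \<rho>"
    unfolding E_space_altdef
    by (intro fps_vs.span_sum fps_vs.span_scale fps_vs.span_base) auto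
  finally show "f \<in> E_space \<nu> \<rho>" .
qed

lemma subspace_E: "fps_vs.subspace (E_space \<nu> \<rho>)"
  by (simp add: E_space_def fps_vs.subspace_span)

lemma closed_E: "closed (E_space \<nu> \<rho>)"
proof -
  have "open (- E_space \<nu> \<rho>)"
    unfolding open_fps_iff
  proof
    fix f
    assume "f \<in> - E_space \<nu> \<rho>"
    then obtain n where n: "int n > \<nu>" "fps_nth f n \<noteq> 0" by (auto simp: E_space_eq)
    \<comment> \<open>Truncation at \<open>Suc n\<close> still sees the coefficient at
      \<open>n\<close> that keeps \<open>f\<close> outside E.\<close>
    have "g \<in> - E_space \<nu> \<rho>" if "fps_cutoff (Suc n) g = fps_cutoff (Suc n) f" for g
    proof -
      have "fps_nth g n = fps_nth (fps_cutoff (Suc n) g) n" by (simp add: fps_cutoff_def)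
      also have "\<dots> = fps_nth (fps_cutoff (Suc n) f) n" by (simp only: that)
      also have "\<dots> = fps_nth f n" by (simp add: fps_cutoff_def)
      finally have "fps_nth g n \<noteq> 0" using n(2) by (simp only: not_False_eq_True)
      then show ?thesis using n(1) by (simp add: E_space_eq) (rule exI[of _ n], simp)
    qed
    then have "{g. fps_cutoff (Suc n) g = fps_cutoff (Suc n) f} \<subseteq> - E_space \<nu> \<rho>" by blast
    then show "\<exists>n. {g. fps_cutoff n g = fps_cutoff n f} \<subseteq> - E_space \<nu> \<rho>" by blast
  qed
  then show ?thesis by (simp add: closed_def)
qed

lemma invariant_fps_E: "invariant_fps \<nu> \<rho> (E_space \<nu> \<rho>)"
proof
  fix z f
  assume "f \<in> E_space \<nu> \<rho>"
  then show "fps_op \<nu> \<rho> z f \<in> E_space \<nu> \<rho>"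
    unfolding E_space_eq
  proof (intro CollectI allI impI)
    fix n
    assume f: "f \<in> {f. \<forall>n. \<nu> < int n \<longrightarrow> fps_nth f n = 0}" and n: "\<nu> < int n"
    \<comment> \<open>Only X- raises the index. It could leave E only from \<nu> to \<nu> + 1, and
      there its coefficient vanishes.\<close>
    have "of_int (int (n - 1)) = (of_int \<nu> :: complex)" if "n > 0" "\<not> \<nu> < int (n - 1)"
      using that n by (simp only: of_int_eq_iff)
    then show "fps_nth (fps_op \<nu> \<rho> z f) n = 0"
      using f n by (cases z; cases "\<nu> < int (n - 1)") auto
  qed
qed (rule subspace_E closed_E)+

lemma dim_E: "\<nu> \<ge> 0 \<Longrightarrow> fps_vs.dim (E_space \<nu> \<rho>) = nat \<nu> + 1"
proof -
  assume "\<nu> \<ge> 0"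
  then have "{l. int l \<le> \<nu>} = {..nat \<nu>}" by auto
  moreover have "card ((\<lambda>l. fps_X ^ l :: complex fps) ` {..nat \<nu>}) = nat \<nu> + 1"
    by (subst card_image) (auto intro: inj_on_subset[OF inj_X_power])
  ultimately show ?thesis
    unfolding E_space_altdef by (simp add: fps_vs.dim_eq_card_independent independent_X_powers)
qed

section \<open>The subrepresentation and the quotient\<close>

lemma E_space_proper:
  assumes "\<nu> \<ge> 0"
  shows "E_space \<nu> \<rho> \<noteq> {0}" "E_space \<nu> \<rho> \<noteq> UNIV"
proof -
  have "1 \<in> E_space \<nu> \<rho>" using assms by (auto simp: E_space_eq fps_one_nth)
  then show "E_space \<nu> \<rho> \<noteq> {0}" by (metis singletonD zero_neq_one)
  have "fps_X ^ (nat \<nu> + 1) \<notin> E_space \<nu> \<rho>"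
    using assms by (auto simp: E_space_eq fps_X_power_nth intro!: exI[of _ "nat \<nu> + 1"])
  then show "E_space \<nu> \<rho> \<noteq> UNIV" by blast
qed

lemma invariant_subspace_E:
  assumes "even (\<rho> - \<nu>)"
  shows "invariant_subspace (C_rep \<nu> \<rho>) (E_space \<nu> \<rho>)"
  using invariant_fps_E invariant_fps_iff[OF assms] by blast

lemma representation_subrep:
  assumes "even (\<rho> - \<nu>)" and W: "invariant_subspace (C_rep \<nu> \<rho>) W"
  shows "representation (subrep (C_rep \<nu> \<rho>) W)"
proof -
  have sub: "fps_vs.subspace W" and act: "\<And>Z f. f \<in> W \<Longrightarrow> act (C_rep \<nu> \<rho>) Z f \<in> W"
    using W by (simp_all add: invariant_subspace_def subspace_of_C_rep)
  have "\<exists>y\<in>W. x + y = 0" if "x \<in> W" for x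
    using fps_vs.subspace_neg[OF sub that] by (intro bexI[of _ "- x"]) simp_all
  then have "vspace (subrep (C_rep \<nu> \<rho>) W)"
    unfolding vspace_def subrep_def
    by (simp add: fps_vs.subspace_0 fps_vs.subspace_add fps_vs.subspace_scale sub algebra_simps
        fps_vs.scale_right_distrib fps_vs.scale_left_distrib)
  moreover have "act (C_rep \<nu> \<rho>) (monom [gK]) x = fps_scale (if even n then 1 else -1) x"
    if "act (C_rep \<nu> \<rho>) (monom [gA]) x = fps_scale (of_int n) x" for n x
    using representation_C_rep[OF assms(1)] that by (simp add: representation_def)
  ultimately show ?thesis
    unfolding representation_def by (simp add: subrep_def act C_rep_act_linear[OF assms(1)])
qed

lemma irreducible_subrep_E:
  assumes "even (\<rho> - \<nu>)" "\<nu> \<ge> 0"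
  shows "irreducible_rep (subrep (C_rep \<nu> \<rho>) (E_space \<nu> \<rho>))"
  unfolding irreducible_rep_def
proof (intro conjI allI impI)
  let ?S = "subrep (C_rep \<nu> \<rho>) (E_space \<nu> \<rho>)"
  show "representation ?S"
    by (intro representation_subrep assms invariant_subspace_E)
  show "vcarrier ?S \<noteq> {vzero ?S}"
    using E_space_proper[OF assms(2)] by (simp add: subrep_def)
  fix W
  assume W: "invariant_subspace ?S W \<and> closedin (vtop ?S) W"
  then have E: "W \<subseteq> E_space \<nu> \<rho>"
    by (simp add: invariant_subspace_def subspace_of_def subrep_def)
  \<comment> \<open>E is closed, so a subset closed in E is closed in the whole space and the
    results on closed invariant subspaces apply.\<close>
  have "closedin euclidean W"
    by (rule closedin_trans_full[of _ "E_space \<nu> \<rho>"]) (use W closed_E in \<open>simp_all add: subrep_def\<close>)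
  moreover have "invariant_subspace (C_rep \<nu> \<rho>) W"
    using W by (simp add: invariant_subspace_def subspace_of_def subrep_def)
  ultimately interpret invariant_fps \<nu> \<rho> W by (simp add: invariant_fps_iff[OF assms(1)])
  show "W = {vzero ?S} \<or> W = vcarrier ?S"
  proof (cases "\<exists>f\<in>W. f \<noteq> 0")
    case True
    then obtain f l where f: "f \<in> W" "fps_nth f l \<noteq> 0" by (auto simp: fps_eq_iff)
    \<comment> \<open>Powers up to \<nu> are reached from any index without the forbidden
      step.\<close>
    have "E_space \<nu> \<rho> \<subseteq> W"
      unfolding E_space_altdef
      using X_power_below[OF f] by (intro fps_vs.span_minimal W) auto
    with E show ?thesis by (simp add: subrep_def)
  next
    case False
    then show ?thesis using fps_vs.subspace_0[OF W] by (auto simp: subrep_def)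
  qed
qed

section \<open>The quotient topology\<close>

lemma openin_quotient_topology:
  "openin (quotient_topology X q) S \<longleftrightarrow> S \<subseteq> q ` topspace X \<and> openin X {x \<in> topspace X. q x \<in> S}"
proof -
  \<comment> \<open>The topology axioms hold because preimages commute with unions and
    intersections.\<close>
  have "openin X {x \<in> topspace X. q x \<in> \<Union>\<K>}"
    if "\<forall>K\<in>\<K>. K \<subseteq> q ` topspace X \<and> openin X {x \<in> topspace X. q x \<in> K}" for \<K>
  proof -
    have "{x \<in> topspace X. q x \<in> \<Union>\<K>} = \<Union>((\<lambda>K. {x \<in> topspace X. q x \<in> K}) ` \<K>)" by blast
    then show ?thesis using that by auto
  qed
  moreover have "openin X {x \<in> topspace X. q x \<in> S \<inter> T}"
    if "openin X {x \<in> topspace X. q x \<in> S}" "openin X {x \<in> topspace X. q x \<in> T}" for S T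
    using openin_Int[OF that] by (rule back_subst[of "openin X"]) blast
  ultimately have "istopology (\<lambda>U. U \<subseteq> q ` topspace X \<and> openin X {x \<in> topspace X. q x \<in> U})"
    unfolding istopology_def by blast
  then show ?thesis by (simp add: quotient_topology_def)
qed

lemma topspace_quotient_topology: "topspace (quotient_topology X q) = q ` topspace X"
proof -
  have "{x \<in> topspace X. q x \<in> q ` topspace X} = topspace X" by blast
  then have "openin (quotient_topology X q) (q ` topspace X)"
    by (simp add: openin_quotient_topology)
  then show ?thesis
    using openin_subset openin_quotient_topology[of X q "topspace (quotient_topology X q)"] by fastforce
qed

lemma closedin_quotient_topology:
  assumes "closedin (quotient_topology X q) S"
  shows "closedin X {x \<in> topspace X. q x \<in> S}"
proof -
  have "openin X {x \<in> topspace X. q x \<in> q ` topspace X - S}"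
    using assms by (simp add: closedin_def openin_quotient_topology topspace_quotient_topology)
  also have "{x \<in> topspace X. q x \<in> q ` topspace X - S} =
      topspace X - {x \<in> topspace X. q x \<in> S}" by blast
  finally show ?thesis by (auto simp: closedin_def)
qed

section \<open>The quotient representation, computed on representatives\<close>

abbreviation quot :: "int \<Rightarrow> int \<Rightarrow> complex fps \<Rightarrow> complex fps set" where
  "quot \<nu> \<rho> \<equiv> vcoset (C_rep \<nu> \<rho>) (E_space \<nu> \<rho>)"

lemma mem_quot: "g \<in> quot \<nu> \<rho> f \<longleftrightarrow> g - f \<in> E_space \<nu> \<rho>"
  by (force simp: vcoset_def image_iff algebra_simps)

lemma quot_eq_iff: "quot \<nu> \<rho> f = quot \<nu> \<rho> g \<longleftrightarrow> f - g \<in> E_space \<nu> \<rho>"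
proof
  assume "quot \<nu> \<rho> f = quot \<nu> \<rho> g"
  moreover have "f \<in> quot \<nu> \<rho> f" by (simp add: mem_quot fps_vs.subspace_0 subspace_E)
  ultimately show "f - g \<in> E_space \<nu> \<rho>" by (simp add: mem_quot)
next
  assume fg: "f - g \<in> E_space \<nu> \<rho>"
  have "h - f \<in> E_space \<nu> \<rho> \<longleftrightarrow> h - g \<in> E_space \<nu> \<rho>" for h
    using fps_vs.subspace_add[OF subspace_E fg, of "h - f"]
      fps_vs.subspace_diff[OF subspace_E _ fg, of "h - g"] by (auto simp: algebra_simps)
  then show "quot \<nu> \<rho> f = quot \<nu> \<rho> g" by (auto simp: mem_quot)
qed

lemma quot_0: "quot \<nu> \<rho> 0 = E_space \<nu> \<rho>"
  by (auto simp: mem_quot)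

lemma quotient_rep_simps:
  "vcarrier (quotient_rep (C_rep \<nu> \<rho>) (E_space \<nu> \<rho>)) = range (quot \<nu> \<rho>)"
  "vzero (quotient_rep (C_rep \<nu> \<rho>) (E_space \<nu> \<rho>)) = quot \<nu> \<rho> 0"
  "vadd (quotient_rep (C_rep \<nu> \<rho>) (E_space \<nu> \<rho>)) (quot \<nu> \<rho> f) (quot \<nu> \<rho> g) = quot \<nu> \<rho> (f + g)"
  "vscale (quotient_rep (C_rep \<nu> \<rho>) (E_space \<nu> \<rho>)) c (quot \<nu> \<rho> f) = quot \<nu> \<rho> (fps_scale c f)"
  "vtop (quotient_rep (C_rep \<nu> \<rho>) (E_space \<nu> \<rho>)) = quotient_topology euclidean (quot \<nu> \<rho>)"
proof -
  have self: "f \<in> quot \<nu> \<rho> f" for f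
    by (simp add: mem_quot fps_vs.subspace_0 subspace_E)
  note E = fps_vs.subspace_add[OF subspace_E] fps_vs.subspace_scale[OF subspace_E]
  have "{x + y |x y. x \<in> quot \<nu> \<rho> f \<and> y \<in> quot \<nu> \<rho> g} = quot \<nu> \<rho> (f + g)"
  proof (intro equalityI subsetI)
    fix h
    assume "h \<in> quot \<nu> \<rho> (f + g)"
    then have "h = f + (h - f) \<and> f \<in> quot \<nu> \<rho> f \<and> h - f \<in> quot \<nu> \<rho> g"
      using self by (simp add: mem_quot algebra_simps)
    then show "h \<in> {x + y |x y. x \<in> quot \<nu> \<rho> f \<and> y \<in> quot \<nu> \<rho> g}" by blast
  next
    fix h
    assume "h \<in> {x + y |x y. x \<in> quot \<nu> \<rho> f \<and> y \<in> quot \<nu> \<rho> g}"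
    then obtain x y where "h = x + y" "x - f \<in> E_space \<nu> \<rho>" "y - g \<in> E_space \<nu> \<rho>"
      by (auto simp: mem_quot)
    then show "h \<in> quot \<nu> \<rho> (f + g)"
      using E(1)[of "x - f" \<nu> \<rho> "y - g"] by (simp add: mem_quot algebra_simps)
  qed
  then show "vadd (quotient_rep (C_rep \<nu> \<rho>) (E_space \<nu> \<rho>)) (quot \<nu> \<rho> f) (quot \<nu> \<rho> g) = quot \<nu> \<rho> (f + g)"
    by (simp add: quotient_rep_def)
  \<comment> \<open>The summand \<open>w\<close> fills up the coset, also for \<open>c = 0\<close>,
    where the multiples of \<open>x\<close> collapse to zero.\<close>
  have "{fps_scale c x + w |x w. x \<in> quot \<nu> \<rho> f \<and> w \<in> E_space \<nu> \<rho>} = quot \<nu> \<rho> (fps_scale c f)"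
  proof (intro equalityI subsetI)
    fix h
    assume "h \<in> quot \<nu> \<rho> (fps_scale c f)"
    then have "h = fps_scale c f + (h - fps_scale c f) \<and> f \<in> quot \<nu> \<rho> f \<and>
        h - fps_scale c f \<in> E_space \<nu> \<rho>"
      using self by (simp add: mem_quot)
    then show "h \<in> {fps_scale c x + w |x w. x \<in> quot \<nu> \<rho> f \<and> w \<in> E_space \<nu> \<rho>}" by blast
  next
    fix h
    assume "h \<in> {fps_scale c x + w |x w. x \<in> quot \<nu> \<rho> f \<and> w \<in> E_space \<nu> \<rho>}"
    then obtain x w where h: "h = fps_scale c x + w" "x - f \<in> E_space \<nu> \<rho>" "w \<in> E_space \<nu> \<rho>"
      by (auto simp: mem_quot)
    then have "fps_scale c (x - f) + w \<in> E_space \<nu> \<rho>" by (intro E)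
    then show "h \<in> quot \<nu> \<rho> (fps_scale c f)"
      by (simp add: mem_quot h fps_vs.scale_right_diff_distrib algebra_simps)
  qed
  then show "vscale (quotient_rep (C_rep \<nu> \<rho>) (E_space \<nu> \<rho>)) c (quot \<nu> \<rho> f) = quot \<nu> \<rho> (fps_scale c f)"
    by (simp add: quotient_rep_def)
qed (simp_all add: quotient_rep_def quot_0)

text \<open>Invariance of E makes the image coset independent of the representative.\<close>

lemma quotient_rep_act:
  assumes "even (\<rho> - \<nu>)"
  shows "act (quotient_rep (C_rep \<nu> \<rho>) (E_space \<nu> \<rho>)) Z (quot \<nu> \<rho> f) =
    quot \<nu> \<rho> (act (C_rep \<nu> \<rho>) Z f)"
proof -
  let ?a = "act (C_rep \<nu> \<rho>) Z"
  have act_diff: "?a (x - y) = ?a x - ?a y" for x y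
    using C_rep_act_linear(1)[OF assms, of Z "x - y" y] by simp
  have E: "?a x \<in> E_space \<nu> \<rho>" if "x \<in> E_space \<nu> \<rho>" for x
    using invariant_subspace_E[OF assms] that by (simp add: invariant_subspace_def)
  have "{?a x + w |x w. x \<in> quot \<nu> \<rho> f \<and> w \<in> E_space \<nu> \<rho>} = quot \<nu> \<rho> (?a f)"
  proof (intro equalityI subsetI)
    fix h
    assume "h \<in> quot \<nu> \<rho> (?a f)"
    then have "h = ?a f + (h - ?a f) \<and> f \<in> quot \<nu> \<rho> f \<and> h - ?a f \<in> E_space \<nu> \<rho>"
      by (simp add: mem_quot fps_vs.subspace_0 subspace_E)
    then show "h \<in> {?a x + w |x w. x \<in> quot \<nu> \<rho> f \<and> w \<in> E_space \<nu> \<rho>}" by blast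
  next
    fix h
    assume "h \<in> {?a x + w |x w. x \<in> quot \<nu> \<rho> f \<and> w \<in> E_space \<nu> \<rho>}"
    then obtain x w where h: "h = ?a x + w" "x - f \<in> E_space \<nu> \<rho>" "w \<in> E_space \<nu> \<rho>"
      by (auto simp: mem_quot)
    then have "?a (x - f) + w \<in> E_space \<nu> \<rho>" by (intro fps_vs.subspace_add subspace_E E)
    then show "h \<in> quot \<nu> \<rho> (?a f)" by (simp add: mem_quot h act_diff algebra_simps)
  qed
  then show ?thesis by (simp add: quotient_rep_def)
qed

lemma representation_quotient:
  assumes "even (\<rho> - \<nu>)"
  shows "representation (quotient_rep (C_rep \<nu> \<rho>) (E_space \<nu> \<rho>))"
proof -
  let ?Q = "quotient_rep (C_rep \<nu> \<rho>) (E_space \<nu> \<rho>)"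
  have "\<exists>g. quot \<nu> \<rho> (f + g) = quot \<nu> \<rho> 0" for f
    by (rule exI[of _ "- f"]) simp
  then have "vspace ?Q"
    unfolding vspace_def
    by (simp add: quotient_rep_simps topspace_quotient_topology algebra_simps
        fps_vs.scale_right_distrib fps_vs.scale_left_distrib)
  \<comment> \<open>An eigenvector equation in the quotient holds modulo E, which is the form
    treated by \<open>K_clause\<close>.\<close>
  then show ?thesis
    using K_clause[OF _ subspace_E, of \<nu> \<rho>]
    unfolding representation_def
    by (simp add: quotient_rep_simps quotient_rep_act[OF assms] C_rep_act_linear[OF assms]
        C_rep_act_gen[OF assms] quot_eq_iff rangeI del: fps_op.simps)
qed

lemma irreducible_quotient:
  assumes "even (\<rho> - \<nu>)" "\<nu> \<ge> 0"
  shows "irreducible_rep (quotient_rep (C_rep \<nu> \<rho>) (E_space \<nu> \<rho>))"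
  unfolding irreducible_rep_def
proof (intro conjI allI impI)
  let ?Q = "quotient_rep (C_rep \<nu> \<rho>) (E_space \<nu> \<rho>)"
  show "representation ?Q" by (rule representation_quotient[OF assms(1)])
  obtain f where "f \<notin> E_space \<nu> \<rho>" using E_space_proper[OF assms(2)] by blast
  then have "quot \<nu> \<rho> f \<noteq> quot \<nu> \<rho> 0" by (simp add: quot_eq_iff)
  then show "vcarrier ?Q \<noteq> {vzero ?Q}" unfolding quotient_rep_simps by blast
  fix W
  assume W: "invariant_subspace ?Q W \<and> closedin (vtop ?Q) W"
  \<comment> \<open>The preimage is a closed invariant subspace of power series, to which the
    results above apply.\<close>
  define V where "V = {f. quot \<nu> \<rho> f \<in> W}"
  have sub: "W \<subseteq> range (quot \<nu> \<rho>)" "quot \<nu> \<rho> 0 \<in> W"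
    and add: "\<And>x y. x \<in> W \<Longrightarrow> y \<in> W \<Longrightarrow> vadd ?Q x y \<in> W"
    and scale: "\<And>c x. x \<in> W \<Longrightarrow> vscale ?Q c x \<in> W"
    and act: "\<And>Z x. x \<in> W \<Longrightarrow> act ?Q Z x \<in> W"
    using W by (simp_all add: invariant_subspace_def subspace_of_def quotient_rep_simps)
  have "invariant_fps \<nu> \<rho> V"
  proof
    have "quot \<nu> \<rho> (f + g) \<in> W" if "quot \<nu> \<rho> f \<in> W" "quot \<nu> \<rho> g \<in> W" for f g
      using add[OF that] by (simp add: quotient_rep_simps)
    moreover have "quot \<nu> \<rho> (fps_scale c f) \<in> W" if "quot \<nu> \<rho> f \<in> W" for c f
      using scale[OF that] by (simp add: quotient_rep_simps)
    ultimately show "fps_vs.subspace V"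
      using sub(2) by (simp add: fps_vs.subspace_def V_def)
    show "closed V"
      using W closedin_quotient_topology[of euclidean "quot \<nu> \<rho>" W]
      by (simp add: quotient_rep_simps V_def)
    show "fps_op \<nu> \<rho> z f \<in> V" if "f \<in> V" for z f
      using that act[of "quot \<nu> \<rho> f" "monom [z]"]
      by (simp add: V_def quotient_rep_act[OF assms(1)] C_rep_act_gen[OF assms(1)] del: fps_op.simps)
  qed
  then interpret invariant_fps \<nu> \<rho> V .
  show "W = {vzero ?Q} \<or> W = vcarrier ?Q"
  proof (cases "V \<subseteq> E_space \<nu> \<rho>")
    case True
    then have "quot \<nu> \<rho> f = quot \<nu> \<rho> 0" if "quot \<nu> \<rho> f \<in> W" for f
      using that by (auto simp: V_def quot_eq_iff)
    with sub show ?thesis unfolding quotient_rep_simps by blast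
  next
    case False
    \<comment> \<open>An element outside E has a nonzero coefficient beyond \<nu>, from where every
      index is reachable.\<close>
    then obtain f l where "f \<in> V" "fps_nth f l \<noteq> 0" "int l > \<nu>" by (auto simp: E_space_eq)
    then have "V = UNIV" by (intro eq_UNIV) auto
    with sub show ?thesis unfolding quotient_rep_simps V_def by blast
  qed
qed

lemma infinite_dimensional_quotient:
  "infinite_dimensional (quotient_rep (C_rep \<nu> \<rho>) (E_space \<nu> \<rho>))"
  unfolding infinite_dimensional_def
proof (rule notI, elim exE conjE)
  let ?Q = "quotient_rep (C_rep \<nu> \<rho>) (E_space \<nu> \<rho>)"
  fix S
  assume S: "finite S" "S \<subseteq> vcarrier ?Q"
    and spans: "\<forall>W. subspace_of ?Q W \<and> S \<subseteq> W \<longrightarrow> W = vcarrier ?Q"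
  from S obtain T where T: "finite T" "S = quot \<nu> \<rho> ` T"
    unfolding quotient_rep_simps by (meson finite_subset_image)
  \<comment> \<open>Lifts of a finite spanning set together with the finite basis of E would span
    all power series.\<close>
  define B where "B = T \<union> (\<lambda>l. fps_X ^ l) ` {l. int l \<le> \<nu>}"
  have E: "E_space \<nu> \<rho> \<subseteq> fps_vs.span B"
    unfolding E_space_altdef B_def by (rule fps_vs.span_mono) simp
  have "subspace_of ?Q (quot \<nu> \<rho> ` fps_vs.span B)"
    unfolding subspace_of_def
    by (auto simp: quotient_rep_simps fps_vs.span_zero fps_vs.span_add fps_vs.span_scale)
  moreover have "S \<subseteq> quot \<nu> \<rho> ` fps_vs.span B"
    by (auto simp: T B_def intro!: imageI fps_vs.span_base)
  ultimately have eq: "quot \<nu> \<rho> ` fps_vs.span B = range (quot \<nu> \<rho>)"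
    using spans by (simp add: quotient_rep_simps)
  have "f \<in> fps_vs.span B" for f
  proof -
    obtain g where g: "g \<in> fps_vs.span B" "quot \<nu> \<rho> f = quot \<nu> \<rho> g" using eq by blast
    then have "f - g \<in> fps_vs.span B" using E by (auto simp: quot_eq_iff)
    from fps_vs.span_add[OF this g(1)] show ?thesis by simp
  qed
  moreover have "finite B"
  proof -
    have "{l. int l \<le> \<nu>} \<subseteq> {..nat \<nu>}" by auto
    then show ?thesis using T(1) by (auto simp: B_def intro: finite_subset)
  qed
  ultimately show False using finite_span_neq_UNIV by blast
qed

section \<open>Reducibility, expansion in v, and assembly\<close>

lemma reducible_C_rep:
  assumes "even (\<rho> - \<nu>)" "\<nu> \<ge> 0"
  shows "reducible (C_rep \<nu> \<rho>)"
  unfolding reducible_def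
  using representation_C_rep[OF assms(1)] invariant_subspace_E[OF assms(1)] closed_E
    E_space_proper[OF assms(2)]
  by (auto intro!: exI[of _ "E_space \<nu> \<rho>"])

text \<open>Each v is the corresponding u up to sign, so the coefficients are those of \<phi>
  divided by \<open>vsign\<close>.\<close>

lemma v_vec_expansion:
  "\<exists>!\<alpha>. (\<lambda>l. fps_scale (\<alpha> l) (series \<nu> \<rho> (v_vec \<nu> \<rho> l))) sums \<phi>"
proof -
  have "series \<nu> \<rho> (v_vec \<nu> \<rho> l) = fps_scale (vsign l) (fps_X ^ l)" for l
    by (simp add: v_vec_eq series_eq_\<Phi> alg_vs.span_scale \<Phi>_scale \<Phi>_u_vec)
  then have "(\<lambda>l. fps_scale (\<alpha> l) (series \<nu> \<rho> (v_vec \<nu> \<rho> l))) sums \<phi> \<longleftrightarrow>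
      (\<lambda>l. \<alpha> l * vsign l) = fps_nth \<phi>" for \<alpha>
    using sums_X_power_iff[of "\<lambda>l. \<alpha> l * vsign l" \<phi>] by simp
  moreover have "\<alpha> l * vsign l = c \<longleftrightarrow> \<alpha> l = c / vsign l" for \<alpha> c and l :: nat
    by (simp add: field_simps)
  ultimately have "(\<lambda>l. fps_scale (\<alpha> l) (series \<nu> \<rho> (v_vec \<nu> \<rho> l))) sums \<phi> \<longleftrightarrow>
      \<alpha> = (\<lambda>l. fps_nth \<phi> l / vsign l)" for \<alpha>
    by (simp add: fun_eq_iff)
  then show ?thesis by auto
qed

lemma piL_gen: "piL (monom [z]) x = hopf_op z x"
  by (simp add: piL_eq)

lemma highest_weight:
  assumes "even (\<rho> - \<nu>)"
  shows "highest_weight_vector (C_rep \<nu> \<rho>) (- of_int \<rho>) (of_int \<nu>) (series \<nu> \<rho> (u_vec \<nu> \<rho> 0))"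
  unfolding highest_weight_vector_def C_rep_act_gen[OF assms] series_u_vec fps_op_X_power by simp

theorem mainTheorem16:
  fixes \<nu> \<rho> :: int
  assumes "even (\<rho> - \<nu>)"
  shows
    "(\<exists>!\<pi>. is_left_action \<pi>) \<and>
     inj (u_vec \<nu> \<rho>) \<and> alg_vs.independent (range (u_vec \<nu> \<rho>)) \<and>
     (\<forall>f. (\<lambda>l. fps_scale (fps_nth f l) (series \<nu> \<rho> (u_vec \<nu> \<rho> l))) sums f) \<and>
     (\<forall>Z l. piL Z (u_vec \<nu> \<rho> l) \<in> alg_vs.span (range (u_vec \<nu> \<rho>))) \<and>
     (\<forall>Z f. summable (termwise \<nu> \<rho> Z f)) \<and>
     representation (C_rep \<nu> \<rho>) \<and> infinite_dimensional (C_rep \<nu> \<rho>) \<and>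
     (\<forall>l. piL (monom [gA]) (u_vec \<nu> \<rho> l) = (- of_int \<rho>) *\<^sub>C u_vec \<nu> \<rho> l \<and>
          piL (monom [gB]) (u_vec \<nu> \<rho> l) = (of_int \<nu> - 2 * of_nat l) *\<^sub>C u_vec \<nu> \<rho> l \<and>
          piL (monom [gXp]) (u_vec \<nu> \<rho> l) =
            (if l = 0 then 0 else ((-1) ^ (l - 1) * of_nat l) *\<^sub>C u_vec \<nu> \<rho> (l - 1)) \<and>
          piL (monom [gXm]) (u_vec \<nu> \<rho> l) =
            ((-1) ^ (l + 1) * (of_nat l - of_int \<nu>)) *\<^sub>C u_vec \<nu> \<rho> (l + 1)) \<and>
     piL (monom [gXp]) (u_vec \<nu> \<rho> 0) = 0 \<and>
     highest_weight_vector (C_rep \<nu> \<rho>) (- of_int \<rho>) (of_int \<nu>) (series \<nu> \<rho> (u_vec \<nu> \<rho> 0)) \<and>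
     (\<forall>l. v_vec \<nu> \<rho> l \<in> alg_vs.span (range (u_vec \<nu> \<rho>))) \<and>
     (\<forall>\<phi>. \<exists>!\<alpha>. (\<lambda>l. fps_scale (\<alpha> l) (series \<nu> \<rho> (v_vec \<nu> \<rho> l))) sums \<phi>) \<and>
     (\<forall>l. piL (monom [gA]) (v_vec \<nu> \<rho> l) = (- of_int \<rho>) *\<^sub>C v_vec \<nu> \<rho> l \<and>
          piL (monom [gB]) (v_vec \<nu> \<rho> l) = (of_int \<nu> - 2 * of_nat l) *\<^sub>C v_vec \<nu> \<rho> l \<and>
          piL (monom [gXp]) (v_vec \<nu> \<rho> l) =
            (if l = 0 then 0 else of_nat l *\<^sub>C v_vec \<nu> \<rho> (l - 1)) \<and>
          piL (monom [gXm]) (v_vec \<nu> \<rho> l) = (of_int \<nu> - of_nat l) *\<^sub>C v_vec \<nu> \<rho> (l + 1)) \<and>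
     (\<nu> \<ge> 0 \<longrightarrow>
        reducible (C_rep \<nu> \<rho>) \<and>
        piL (monom [gXm]) (u_vec \<nu> \<rho> (nat \<nu>)) = 0 \<and>
        invariant_subspace (C_rep \<nu> \<rho>) (E_space \<nu> \<rho>) \<and>
        fps_vs.dim (E_space \<nu> \<rho>) = nat \<nu> + 1 \<and>
        irreducible_rep (subrep (C_rep \<nu> \<rho>) (E_space \<nu> \<rho>)) \<and>
        irreducible_rep (quotient_rep (C_rep \<nu> \<rho>) (E_space \<nu> \<rho>)) \<and>
        infinite_dimensional (quotient_rep (C_rep \<nu> \<rho>) (E_space \<nu> \<rho>))) \<and>
     (\<not> \<nu> \<ge> 0 \<longrightarrow> irreducible_rep (C_rep \<nu> \<rho>))"
proof (intro conjI allI impI)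
  fix Z :: s14o and l :: nat and f :: "complex fps"
  \<comment> \<open>Convergence and stability of the span were established for representatives in
    the free algebra.\<close>
  obtain p where Z: "Z = abs_alg p" by (cases Z)
  show "piL Z (u_vec \<nu> \<rho> l) \<in> alg_vs.span (range (u_vec \<nu> \<rho>))"
    unfolding Z by (rule series_piL_u_vec[OF assms])
  show "summable (termwise \<nu> \<rho> Z f)"
    unfolding Z by (rule sums_summable[OF termwise_sums[OF assms]])
  show "(\<lambda>l. fps_scale (fps_nth f l) (series \<nu> \<rho> (u_vec \<nu> \<rho> l))) sums f"
    by (simp add: series_u_vec sums_X_power_iff)
  show "v_vec \<nu> \<rho> l \<in> alg_vs.span (range (u_vec \<nu> \<rho>))"
    by (simp add: v_vec_eq alg_vs.span_scale)
next
  assume "\<nu> \<ge> 0"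
  then show "piL (monom [gXm]) (u_vec \<nu> \<rho> (nat \<nu>)) = 0"
    by (simp add: piL_gen u_vec_Xm)
qed (simp_all only: piL_gen u_vec_A[OF assms] u_vec_B u_vec_Xp u_vec_Xm v_vec_op[OF assms]
    ex1_left_action inj_u_vec independent_u_vec representation_C_rep[OF assms]
    infinite_dimensional_C_rep highest_weight[OF assms] v_vec_expansion reducible_C_rep[OF assms]
    invariant_subspace_E[OF assms] dim_E irreducible_subrep_E[OF assms]
    irreducible_quotient[OF assms] infinite_dimensional_quotient irreducible_C_rep[OF assms]
    not_le if_True simp_thms)

end
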